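(* Consider the mean field dynamics of a $2\times2$ traffic game, with flow $\phi_t$ on $\mathbb{R}^4$. Then for almost all initial conditions $x_0\in\mathbb{R}^4$ the corresponding orbit $x(t)=\phi_t(x_0)$ converges to a rest point as $t\to\infty$. Moreover, the union of the basins of attraction of all the rest points is dense in $\mathbb{R}^4$.
   Context: $2\times2$ traffic game: players $i\in\{1,2\}$, routes $r\in\{a,b\}$, real travel times $C_1^r\le C_2^r$ for each route $r$, and parameters $\beta_1,\beta_2>0$. The state is $x=(x^{1a},x^{1b},x^{2a},x^{2b})\in\mathbb{R}^4$, with $x^i=(x^{ia},x^{ib})$. Logit probabilities: $\pi^{ir}(x^i)=\dfrac{e^{-\beta_i x^{ir}}}{e^{-\beta_i x^{ia}}+e^{-\beta_i x^{ib}}}$. With $j\ne i$ the other player, $C^{ir}(x^{j})=C_1^r+(C_2^r-C_1^r)\,\pi^{jr}(x^j)$. Mean field dynamics: $\dot x^{ir}=\pi^{ir}(x^i)\,\bigl(C^{ir}(x^{j})-x^{ir}\bigr)$ for $i\in\{1,2\}$, $r\in\{a,b\}$, $j\neq i$. A rest point (steady state) is an $x$ with $x^{ir}=C^{ir}(x^j)$ for all $i,r$. $\phi_t(x_0)$, $t\ge0$, denotes the solution with $x(0)=x_0$. The basin of attraction of a rest point $e$ is the set of $x_0$ with $\phi_t(x_0)\to e$ as $t\to\infty$. "Almost all" is with respect to Lebesgue measure. *)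

theory Defs
  imports "HOL-Analysis.Analysis"
begin

text \<open>
  Players 1, 2 and routes a, b are both indexed by the two-element type \<^typ>\<open>2\<close>, whose
  elements are \<open>1\<close> and \<open>2\<close> (the latter being equal to \<open>0\<close>); route a is \<open>1\<close>, route b is \<open>2\<close>.
  The state space of dimension four is the Euclidean space of vectors \<open>x\<close> with entries
  \<open>x $ i $ r\<close>, so that \<open>x $ i\<close> is the state of player \<open>i\<close>.
\<close>

type_synonym player = 2
type_synonym route = 2
type_synonym state = "real ^ route ^ player"

definition other :: "player \<Rightarrow> player" where
  "other i = (if i = 1 then 2 else 1)"

definition logit :: "real \<Rightarrow> real ^ route \<Rightarrow> route \<Rightarrow> real" where
  "logit b y r = exp (- b * y $ r) / (exp (- b * y $ 1) + exp (- b * y $ 2))"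

text \<open>\<open>C1 r\<close> and \<open>C2 r\<close> are the travel times on route \<open>r\<close> when it is used by one,
  respectively by two players; \<open>y\<close> is the state of the opponent of player \<open>i\<close>.\<close>

definition cost ::
  "(player \<Rightarrow> real) \<Rightarrow> (route \<Rightarrow> real) \<Rightarrow> (route \<Rightarrow> real) \<Rightarrow> player \<Rightarrow> route \<Rightarrow> real ^ route \<Rightarrow> real" where
  "cost \<beta> C1 C2 i r y = C1 r + (C2 r - C1 r) * logit (\<beta> (other i)) y r"

definition mean_field ::
  "(player \<Rightarrow> real) \<Rightarrow> (route \<Rightarrow> real) \<Rightarrow> (route \<Rightarrow> real) \<Rightarrow> state \<Rightarrow> state" where
  "mean_field \<beta> C1 C2 x =
     (\<chi> i r. logit (\<beta> i) (x $ i) r * (cost \<beta> C1 C2 i r (x $ other i) - x $ i $ r))"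

definition rest_point ::
  "(player \<Rightarrow> real) \<Rightarrow> (route \<Rightarrow> real) \<Rightarrow> (route \<Rightarrow> real) \<Rightarrow> state \<Rightarrow> bool" where
  "rest_point \<beta> C1 C2 x \<longleftrightarrow> (\<forall>i r. x $ i $ r = cost \<beta> C1 C2 i r (x $ other i))"

definition solution_from ::
  "(player \<Rightarrow> real) \<Rightarrow> (route \<Rightarrow> real) \<Rightarrow> (route \<Rightarrow> real) \<Rightarrow> state \<Rightarrow> (real \<Rightarrow> state) \<Rightarrow> bool" where
  "solution_from \<beta> C1 C2 x0 x \<longleftrightarrow>
     x 0 = x0 \<and>
     (\<forall>t\<ge>0. (x has_vector_derivative mean_field \<beta> C1 C2 (x t)) (at t within {0..}))"

text \<open>The description is over the value at time \<open>t\<close> rather than over the trajectory, because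
  a solution is unique only on \<open>{0..}\<close> and arbitrary at negative times; the flow is
  meaningful for \<open>t \<ge> 0\<close> only. The vector field is smooth with linear growth, so for
  \<open>t \<ge> 0\<close> the described value exists and is unique.\<close>

definition flow ::
  "(player \<Rightarrow> real) \<Rightarrow> (route \<Rightarrow> real) \<Rightarrow> (route \<Rightarrow> real) \<Rightarrow> real \<Rightarrow> state \<Rightarrow> state" where
  "flow \<beta> C1 C2 t x0 = (THE y. \<exists>x. solution_from \<beta> C1 C2 x0 x \<and> x t = y)"

definition basin ::
  "(player \<Rightarrow> real) \<Rightarrow> (route \<Rightarrow> real) \<Rightarrow> (route \<Rightarrow> real) \<Rightarrow> state \<Rightarrow> state set" where
  "basin \<beta> C1 C2 e = {x0. ((\<lambda>t. flow \<beta> C1 C2 t x0) \<longlongrightarrow> e) at_top}"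

end

theory Submission
  imports Defs
begin

text \<open>
  Every orbit converges to a rest point, not merely almost every one, so both claims follow at once.
  The reason is a Lyapunov function, available for all parameters and all initial states.

  Write \<open>z i = x $ i $ 1 - x $ i $ 2\<close> and let \<open>\<sigma>\<close> be the logistic function. For player \<open>i\<close> and
  route \<open>r\<close>, the opponent \<open>j\<close> enters the travel time only through \<open>\<zeta> = \<plusminus> z j\<close>, as
  \<open>C1 r + (C2 r - C1 r) * \<sigma> (\<beta> j * \<zeta>)\<close>, an increasing function of \<open>\<zeta>\<close>; denote it by \<open>T \<zeta>\<close>.
  Let \<open>w\<close> be an antiderivative of the inverse of \<open>T\<close> and put
  \<open>V = z 1 * z 2 + (\<Sum>i r. w i r (x $ i $ r))\<close>. The derivative of the coupling term
  \<open>z 1 * z 2\<close> along an orbit assigns the coefficient \<open>- \<zeta>\<close> to the velocity of \<open>x $ i $ r\<close>, and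
  that velocity is a positive multiple of \<open>T \<zeta> - x $ i $ r\<close>. Hence each of the four coordinates
  contributes to the derivative of \<open>V\<close> a positive multiple of
  \<open>- (w' (x $ i $ r) - \<zeta>) * (x $ i $ r - T \<zeta>)\<close>, which is at most a negative multiple of
  \<open>(x $ i $ r - T \<zeta>)^2\<close> because \<open>w'\<close> is increasing and takes the value \<open>\<zeta>\<close> at \<open>T \<zeta>\<close>.
  (If \<open>C1 r = C2 r\<close>, then \<open>T\<close> is constant and \<open>w\<close> is chosen differently; see
  \<open>route_potential_exists\<close>.) The point of coupling through \<open>z\<close> rather than through the choice
  probabilities is that the speeds \<open>\<pi>\<close>, which differ between routes, only multiply terms that
  already have the right sign.

  Orbits stay in a cube, so \<open>V\<close> is bounded below along them and its dissipation tends to \<open>0\<close>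
  (\<open>dissipation_tendsto_0\<close>): each coordinate approaches its current travel time
  (\<open>delay_tracks_target\<close>). Then each \<open>z i\<close> asymptotically solves a scalar fixed point equation
  \<open>z = H z\<close>, in which \<open>H\<close> is the composition of the two players' logistic responses. If \<open>z i\<close> kept
  oscillating, it would sweep out a whole interval of fixed points of \<open>H\<close>, and there is none
  (\<open>response_fixed_points_isolated\<close>). So \<open>z i\<close> converges, and with it the state
  (\<open>solution_converges\<close>).

  That the flow is given by actual solutions is the Picard-Lindelof theorem, applied to the field
  truncated to the invariant cube, where it is bounded and globally Lipschitz
  (\<open>flow_is_bounded_solution\<close>).
\<close>

section \<open>Ordinary differential equations on the half line\<close>

lemma mvt_half_line:
  fixes f :: "real \<Rightarrow> real"
  assumes f: "\<And>t. 0 \<le> t \<Longrightarrow> (f has_real_derivative f' t) (at t within {0..})"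
    and ab: "0 \<le> a" "a < b"
  obtains s where "a < s" "s < b" "f b - f a = (b - a) * f' s"
proof -
  have "(f has_derivative (*) (f' t)) (at t within {a..b})" if "a \<le> t" "t \<le> b" for t
    using f[of t] ab that unfolding has_field_derivative_def
    by (auto intro: has_derivative_subset)
  from mvt_simple[OF ab(2) this] that show thesis by (auto simp: mult.commute)
qed

lemma has_vector_derivative_indefinite_integral:
  fixes g :: "real \<Rightarrow> 'a::banach"
  assumes g: "continuous_on {0..} g" and t: "0 \<le> t"
  shows "((\<lambda>t. integral {0..t} g) has_vector_derivative g t) (at t within {0..})"
proof -
  have "((\<lambda>t. integral {0..t} g) has_vector_derivative g t) (at t within {0..t+1})"
    using t by (intro integral_has_vector_derivative continuous_on_subset[OF g]) auto
  moreover have "at t within {0..t+1} = at t within {0..}"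
    by (rule at_within_nhd[of t "{..<t+1}"]) (use t in auto)
  ultimately show ?thesis by simp
qed

text \<open>
  Picard iteration on the whole half line at once, by Banach's fixed point theorem. The unknown is
  rescaled to \<open>y t = exp (- l * t) *\<^sub>R x t\<close>: boundedness of \<open>F\<close> makes the rescaled iterates bounded
  functions, and for \<open>l > 2 * L\<close> the Picard operator halves distances in the supremum norm, because
  \<open>exp (- l * t) * integral {0..t} (\<lambda>s. L * exp (l * s)) \<le> L / l\<close>.
\<close>

lemma lipschitz_ode_solution_exists:
  fixes F :: "'a::euclidean_space \<Rightarrow> 'a" and x0 :: 'a
  assumes lip: "L-lipschitz_on UNIV F" and bnd: "\<And>x. norm (F x) \<le> B"
  shows "\<exists>x. x 0 = x0 \<and> (\<forall>t\<ge>0. (x has_vector_derivative F (x t)) (at t within {0..}))"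
proof -
  define l where "l = 2 * L + 1"
  have L0: "0 \<le> L" using lip by (rule lipschitz_on_nonneg)
  then have l0: "0 < l" by (simp add: l_def)
  have B0: "0 \<le> B" using bnd[of 0] norm_ge_zero order_trans by blast
  have contF: "continuous_on UNIV F" using lip by (rule lipschitz_on_continuous_on)
  define G where "G y s = F (exp (l * s) *\<^sub>R apply_bcontfun y s)" for y :: "real \<Rightarrow>\<^sub>C 'a" and s
  \<comment> \<open>Negative times are folded to \<open>0\<close>, since bounded continuous functions live on the whole line.\<close>
  define J where "J y t = integral {0..max 0 t} (G y)" for y :: "real \<Rightarrow>\<^sub>C 'a" and t
  have contG: "continuous_on S (G y)" for y S
    unfolding G_def
    by (rule continuous_on_compose2[OF contF]) (auto intro!: continuous_intros)
  have intG: "G y integrable_on {a..b}" for y a b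
    by (rule integrable_continuous_real[OF contG])
  have J_bound: "norm (J y t) \<le> B * max 0 t" for y t
    unfolding J_def using integral_bound[OF _ contG, of 0 "max 0 t" y B] bnd
    by (simp add: G_def)
  have contJ: "continuous_on UNIV (J y)" for y
  proof -
    have "continuous_on {0..} (\<lambda>t. integral {0..t} (G y))"
      unfolding continuous_on_eq_continuous_within
      using has_vector_derivative_continuous[OF has_vector_derivative_indefinite_integral[OF contG]]
      by simp
    then show ?thesis unfolding J_def
      by (rule continuous_on_compose2) (auto intro!: continuous_intros)
  qed
  define w where "w y t = exp (- l * max 0 t) *\<^sub>R (x0 + J y t)" for y t
  have w_bound: "norm (w y t) \<le> norm x0 + B / l" for y t
  proof -
    define s where "s = max 0 t"
    have s0: "0 \<le> s" by (simp add: s_def)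
    have "l * s \<le> exp (l * s)" using exp_ge_add_one_self[of "l * s"] by linarith
    then have a: "exp (- l * s) * s \<le> 1 / l" using l0
      by (simp add: exp_minus field_simps)
    have "norm (w y t) \<le> exp (- l * s) * (norm x0 + B * s)"
      using norm_triangle_ineq[of x0 "J y t"] J_bound[of y t] by (simp add: w_def s_def)
    also have "\<dots> = exp (- l * s) * norm x0 + B * (exp (- l * s) * s)" by (simp add: algebra_simps)
    also have "\<dots> \<le> 1 * norm x0 + B * (1 / l)"
      using a B0 l0 s0 by (intro add_mono mult_right_mono mult_left_mono) auto
    finally show ?thesis by simp
  qed
  have w_bcont: "w y \<in> bcontfun" for y
    by (rule bcontfun_normI[OF _ w_bound])
       (auto simp: w_def[abs_def] intro!: continuous_intros continuous_on_subset[OF contJ])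
  define T where "T y = Bcontfun (w y)" for y
  have T: "apply_bcontfun (T y) t = w y t" for y t
    by (simp add: T_def Bcontfun_inverse[OF w_bcont])
  have contr: "dist (T y) (T y') \<le> (1/2) * dist y y'" for y y'
  proof (rule dist_bound)
    fix t :: real
    define s where "s = max 0 t"
    define d where "d = dist y y'"
    have s0: "0 \<le> s" by (simp add: s_def)
    have d0: "0 \<le> d" by (simp add: d_def)
    have i1: "((\<lambda>r. L * d * exp (l * r)) has_integral (L * d * exp (l * s) / l - L * d * exp (l * 0) / l)) {0..s}"
      using l0 s0
      by (intro fundamental_theorem_of_calculus)
         (auto simp flip: has_real_derivative_iff_has_vector_derivative intro!: derivative_eq_intros)
    have pt: "norm (G y r - G y' r) \<le> L * d * exp (l * r)" for r
    proof -
      have "norm (G y r - G y' r) \<le> L * dist (exp (l * r) *\<^sub>R apply_bcontfun y r) (exp (l * r) *\<^sub>R apply_bcontfun y' r)"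
        unfolding G_def dist_norm[symmetric] by (rule lipschitz_onD[OF lip]) auto
      also have "\<dots> = L * (exp (l * r) * dist (apply_bcontfun y r) (apply_bcontfun y' r))"
        by (simp add: dist_norm flip: scaleR_diff_right)
      also have "\<dots> \<le> L * (exp (l * r) * d)"
        unfolding d_def using L0 by (intro mult_left_mono dist_bounded) auto
      finally show ?thesis by (simp add: mult_ac)
    qed
    have "dist (apply_bcontfun (T y) t) (apply_bcontfun (T y') t) = exp (- l * s) * norm (integral {0..s} (\<lambda>r. G y r - G y' r))"
      by (simp add: T w_def J_def s_def dist_norm intG integral_diff flip: scaleR_diff_right)
    also have "\<dots> \<le> exp (- l * s) * (L * d * exp (l * s) / l - L * d * exp (l * 0) / l)"
      unfolding integral_unique[OF i1, symmetric]
      by (intro mult_left_mono integral_norm_bound_integral integrable_diff intG has_integral_integrable[OF i1] pt) auto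
    also have "\<dots> = L / l * d - exp (- l * s) * (L * d / l)"
      by (simp add: algebra_simps exp_minus)
    also have "\<dots> \<le> L / l * d" using L0 d0 l0 by simp
    also have "\<dots> \<le> (1/2) * d"
      using L0 d0 by (intro mult_right_mono) (auto simp: l_def field_simps)
    finally show "dist (apply_bcontfun (T y) t) (apply_bcontfun (T y') t) \<le> (1/2) * dist y y'" by (simp add: d_def)
  qed
  obtain y where y: "T y = y"
    using banach_fix_type[of "1/2" T] contr by auto
  define x where "x t = x0 + J y t" for t
  have x_eq: "exp (l * t) *\<^sub>R apply_bcontfun y t = x t" if "0 \<le> t" for t
  proof -
    have "apply_bcontfun y t = exp (- (l * t)) *\<^sub>R (x0 + J y t)"
      using T[of y t] that by (simp add: y w_def)
    then show ?thesis by (simp add: x_def flip: exp_add)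
  qed
  show ?thesis
  proof (intro exI[of _ x] conjI allI impI)
    show "x 0 = x0" by (simp add: x_def J_def)
    fix t :: real assume t: "0 \<le> t"
    have "((\<lambda>t. x0 + integral {0..t} (G y)) has_vector_derivative G y t) (at t within {0..})"
      using has_vector_derivative_add[OF has_vector_derivative_const
          has_vector_derivative_indefinite_integral[OF contG t]] by simp
    then have "(x has_vector_derivative G y t) (at t within {0..})"
      by (rule has_vector_derivative_transform[rotated 2]) (auto simp: x_def J_def t)
    then show "(x has_vector_derivative F (x t)) (at t within {0..})"
      by (simp add: G_def x_eq t)
  qed
qed

text \<open>
  The squared distance of two solutions, damped by \<open>exp (- 2 * L * t)\<close>, cannot increase. The set
  \<open>S\<close> admits fields that are Lipschitz on bounded sets but not globally.
\<close>

lemma lipschitz_ode_solution_unique: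
  fixes F :: "'a::real_inner \<Rightarrow> 'a"
  assumes lip: "L-lipschitz_on S F"
    and x: "\<And>t. 0 \<le> t \<Longrightarrow> (x has_vector_derivative F (x t)) (at t within {0..})" "\<And>t. 0 \<le> t \<Longrightarrow> x t \<in> S"
    and y: "\<And>t. 0 \<le> t \<Longrightarrow> (y has_vector_derivative F (y t)) (at t within {0..})" "\<And>t. 0 \<le> t \<Longrightarrow> y t \<in> S"
    and init: "x 0 = y 0" and t: "0 \<le> t"
  shows "x t = y t"
proof -
  define g where "g s = exp (- (2 * L) * s) * ((x s - y s) \<bullet> (x s - y s))" for s
  have "\<exists>d. (g has_real_derivative d) (at s within {0..}) \<and> d \<le> 0" if "0 \<le> s" for s
  proof -
    let ?z = "x s - y s" and ?dz = "F (x s) - F (y s)"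
    let ?d = "- (2 * L) * exp (- (2 * L) * s) * (?z \<bullet> ?z) + (?z \<bullet> ?dz + ?dz \<bullet> ?z) * exp (- (2 * L) * s)"
    have "((\<lambda>s. x s - y s) has_vector_derivative ?dz) (at s within {0..})"
      using x(1) y(1) that by (intro has_vector_derivative_diff) auto
    then have z: "((\<lambda>s. x s - y s) has_derivative (\<lambda>h. h *\<^sub>R ?dz)) (at s within {0..})"
      unfolding has_vector_derivative_def .
    have "((\<lambda>s. (x s - y s) \<bullet> (x s - y s)) has_real_derivative (?z \<bullet> ?dz + ?dz \<bullet> ?z)) (at s within {0..})"
      unfolding has_field_derivative_def
      by (rule has_derivative_eq_rhs[OF has_derivative_inner[OF z z]]) (auto simp: algebra_simps)
    then have g: "(g has_real_derivative ?d) (at s within {0..})"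
      unfolding g_def by (auto intro!: derivative_eq_intros)
    have "?z \<bullet> ?dz \<le> norm ?z * norm ?dz" by (rule norm_cauchy_schwarz)
    also have "\<dots> \<le> norm ?z * (L * norm ?z)"
      using lipschitz_on_normD[OF lip x(2) y(2)] that by (intro mult_left_mono) auto
    also have "\<dots> = L * (?z \<bullet> ?z)" by (simp add: power2_norm_eq_inner[symmetric] power2_eq_square)
    finally have "2 * (?z \<bullet> ?dz) - 2 * L * (?z \<bullet> ?z) \<le> 0" by simp
    then have "exp (- (2 * L) * s) * (2 * (?z \<bullet> ?dz) - 2 * L * (?z \<bullet> ?z)) \<le> 0"
      by (simp add: mult_le_0_iff)
    then have "?d \<le> 0" by (simp add: inner_commute algebra_simps)
    with g show ?thesis by blast
  qed
  then obtain g' where g': "\<And>s. 0 \<le> s \<Longrightarrow> (g has_real_derivative g' s) (at s within {0..})" "\<And>s. 0 \<le> s \<Longrightarrow> g' s \<le> 0"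
    by metis
  have "g t \<le> g 0"
  proof (cases "t = 0")
    case False
    with t obtain s where "0 < s" "g t - g 0 = (t - 0) * g' s"
      using mvt_half_line[of g g' 0 t] g'(1) by (metis order_refl order_le_less)
    with mult_nonneg_nonpos[OF t g'(2)[of s]] show ?thesis by simp
  qed simp
  then have "exp (- (2 * L) * t) * ((x t - y t) \<bullet> (x t - y t)) \<le> 0" by (simp add: g_def init)
  then have "(x t - y t) \<bullet> (x t - y t) \<le> 0" by (simp add: mult_le_0_iff not_less)
  then show ?thesis by (metis inner_eq_zero_iff inner_ge_zero order_antisym right_minus_eq)
qed

section \<open>Barriers, dissipation and asymptotic fixed points\<close>

text \<open>
  If \<open>f\<close> were above \<open>K\<close> at time \<open>t\<close>, then after the last earlier time at which it was at most \<open>K\<close>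
  it would have risen while its derivative was nonpositive.
\<close>

lemma upper_barrier:
  fixes f :: "real \<Rightarrow> real"
  assumes f: "\<And>t. 0 \<le> t \<Longrightarrow> (f has_real_derivative f' t) (at t within {0..})"
    and f': "\<And>t. 0 \<le> t \<Longrightarrow> K < f t \<Longrightarrow> f' t \<le> 0"
    and f0: "f 0 \<le> K" and t: "0 \<le> t"
  shows "f t \<le> K"
proof (rule ccontr)
  assume "\<not> f t \<le> K"
  then have ft: "K < f t" by simp
  define S where "S = {0..t} \<inter> f -` {..K}"
  have "continuous_on {0..t} f"
    by (rule continuous_on_subset[of "{0..}"], rule DERIV_continuous_on, rule f) auto
  then have "closed S"
    unfolding S_def by (intro continuous_closed_preimage) auto
  moreover have "bounded S" by (rule bounded_subset[of "{0..t}"]) (auto simp: S_def)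
  ultimately have "compact S" by (simp add: compact_eq_bounded_closed)
  moreover have "0 \<in> S" using f0 t by (simp add: S_def)
  ultimately obtain s where s: "s \<in> S" "\<And>r. r \<in> S \<Longrightarrow> r \<le> s"
    using compact_attains_sup[of S] by auto
  have s0: "0 \<le> s" and "s \<le> t" and fs: "f s \<le> K" using s(1) by (simp_all add: S_def)
  then have "s < t" using ft by (cases "s = t") auto
  obtain r where r: "s < r" "r < t" "f t - f s = (t - s) * f' r"
    by (rule mvt_half_line[OF f s0 \<open>s < t\<close>])
  have "r \<notin> S" using s(2)[of r] r(1) by auto
  then have "K < f r" using r(1,2) s0 by (simp add: S_def)
  then have "f' r \<le> 0" using f' r(1) s0 by simp
  then have "(t - s) * f' r \<le> 0" using \<open>s < t\<close> by (simp add: mult_nonneg_nonpos)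
  then show False using r(3) fs ft by simp
qed

lemma lower_barrier:
  fixes f :: "real \<Rightarrow> real"
  assumes f: "\<And>t. 0 \<le> t \<Longrightarrow> (f has_real_derivative f' t) (at t within {0..})"
    and f': "\<And>t. 0 \<le> t \<Longrightarrow> f t < K \<Longrightarrow> 0 \<le> f' t"
    and f0: "K \<le> f 0" and t: "0 \<le> t"
  shows "K \<le> f t"
proof -
  have "- f t \<le> - K"
  proof (rule upper_barrier[of "\<lambda>t. - f t" "\<lambda>t. - f' t"])
    show "((\<lambda>t. - f t) has_real_derivative - f' s) (at s within {0..})" if "0 \<le> s" for s
      using f[OF that] by (rule DERIV_minus)
  qed (use f' f0 t in auto)
  then show ?thesis by simp
qed

text \<open>
  A form of Barbalat's lemma, by the mean value theorem and without integrating \<open>g\<close>: the decrease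
  of \<open>V\<close> over a time span \<open>h\<close> is at least \<open>h\<close> times an intermediate value of \<open>g\<close>, and these decreases
  tend to \<open>0\<close> since \<open>V\<close> converges.
\<close>

lemma dissipation_tendsto_0:
  fixes V :: "real \<Rightarrow> real"
  assumes V: "\<And>t. 0 \<le> t \<Longrightarrow> (V has_real_derivative V' t) (at t within {0..})"
    and dec: "\<And>t. 0 \<le> t \<Longrightarrow> V' t \<le> - g t"
    and nonneg: "\<And>t. 0 \<le> t \<Longrightarrow> 0 \<le> g t"
    and below: "\<And>t. 0 \<le> t \<Longrightarrow> m \<le> V t"
    and unif: "uniformly_continuous_on {0..} g"
  shows "(g \<longlongrightarrow> 0) at_top"
proof (rule tendstoI)
  fix e :: real assume e: "0 < e"
  obtain d where d: "0 < d" "\<And>s t. 0 \<le> s \<Longrightarrow> 0 \<le> t \<Longrightarrow> \<bar>s - t\<bar> < d \<Longrightarrow> \<bar>g s - g t\<bar> < e / 2"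
  proof -
    have "0 < e / 2" using e by simp
    with unif obtain d where "0 < d" "\<forall>t\<in>{0..}. \<forall>s\<in>{0..}. dist s t < d \<longrightarrow> dist (g s) (g t) < e / 2"
      unfolding uniformly_continuous_on_def by blast
    then show thesis by (intro that[of d]) (auto simp: dist_real_def)
  qed
  define h where "h = d / 2"
  have h: "0 < h" "h < d" using d(1) by (auto simp: h_def)
  define l where "l = Inf (V ` {0..})"
  have bdd: "bdd_below (V ` {0..})" using below by (auto intro!: bdd_belowI)
  have l_le: "l \<le> V t" if "0 \<le> t" for t
    unfolding l_def using bdd that by (auto intro!: cInf_lower)
  have "\<exists>v\<in>V ` {0..}. v < l + h * (e / 2)"
    using h e unfolding l_def by (subst cInf_less_iff[symmetric, OF _ bdd]) auto
  then obtain t0 where t0: "0 \<le> t0" "V t0 < l + h * (e / 2)" by auto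
  have anti: "V t \<le> V t0" if "t0 \<le> t" for t
  proof (cases "t = t0")
    case False
    with that have "t0 < t" by simp
    obtain s where s: "t0 < s" "s < t" "V t - V t0 = (t - t0) * V' s"
      by (rule mvt_half_line[OF V t0(1) \<open>t0 < t\<close>])
    have "V' s \<le> 0" using dec[of s] nonneg[of s] s t0 by linarith
    then have "(t - t0) * V' s \<le> 0" using that by (simp add: mult_nonneg_nonpos)
    then show ?thesis using s by simp
  qed simp
  have "dist (g t) 0 < e" if t: "t0 \<le> t" for t
  proof -
    have "0 \<le> t" "t < t + h" using t t0 h by auto
    obtain s where s: "t < s" "s < t + h" "V (t + h) - V t = (t + h - t) * V' s"
      by (rule mvt_half_line[OF V \<open>0 \<le> t\<close> \<open>t < t + h\<close>])
    have "h * g s \<le> h * (- V' s)"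
      using dec[of s] s t t0 h by (intro mult_left_mono) linarith+
    also have "\<dots> = V t - V (t + h)" using s by simp
    also have "\<dots> < h * (e / 2)" using anti[OF t] l_le[of "t + h"] t t0 h by linarith
    finally have "g s < e / 2" using h by simp
    moreover have "\<bar>g s - g t\<bar> < e / 2" using s t t0 h by (intro d(2)) auto
    ultimately have "g t < e" by linarith
    then show ?thesis using nonneg[of t] t t0 by (simp add: dist_real_def)
  qed
  then show "\<forall>\<^sub>F t in at_top. dist (g t) 0 < e"
    unfolding eventually_at_top_linorder by blast
qed

text \<open>
  By the intermediate value theorem, any value that \<open>z\<close> passes at arbitrarily late times is a
  fixed point of \<open>H\<close>. If \<open>l\<close> is a limit point of \<open>z\<close> but not its limit, then all values between \<open>l\<close> and
  some other number are passed in this way.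
\<close>

lemma asymptotic_fixed_point_converges:
  fixes z H :: "real \<Rightarrow> real"
  assumes cont: "continuous_on {0..} z"
    and bound: "\<And>t. 0 \<le> t \<Longrightarrow> \<bar>z t\<bar> \<le> K"
    and asym: "((\<lambda>t. z t - H (z t)) \<longlongrightarrow> 0) at_top"
    and isolated: "\<And>a b. a < b \<Longrightarrow> \<exists>x\<in>{a<..<b}. H x \<noteq> x"
  obtains l where "(z \<longlongrightarrow> l) at_top"
proof -
  have fixed: "H c = c" if lo: "\<And>T. \<exists>t\<ge>T. z t < c" and hi: "\<And>T. \<exists>t\<ge>T. c < z t" for c
  proof -
    have cross: "\<exists>t\<ge>T. z t = c" for T
    proof -
      obtain t where t: "max 0 T \<le> t" "z t < c" using lo by blast
      obtain s where s: "t \<le> s" "c < z s" using hi by blast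
      have "continuous_on {t..s} z" using t by (intro continuous_on_subset[OF cont]) auto
      then obtain r where "t \<le> r" "z r = c" using IVT'[of z t c s] t s by auto
      with t show ?thesis by (intro exI[of _ r]) auto
    qed
    have "\<bar>c - H c\<bar> < e" if e: "0 < e" for e
    proof -
      obtain T where "\<And>t. T \<le> t \<Longrightarrow> \<bar>z t - H (z t)\<bar> < e"
        using tendstoD[OF asym e] by (auto simp: eventually_at_top_linorder dist_real_def)
      then show ?thesis using cross[of T] by blast
    qed
    from this[of "\<bar>c - H c\<bar>"] show ?thesis by (cases "H c = c") auto
  qed
  have "\<forall>n. z (real n) \<in> {-K..K}" using bound by (auto simp: abs_le_iff minus_le_iff)
  then obtain l r where r: "strict_mono r" "((\<lambda>n. z (real n)) \<circ> r) \<longlonglongrightarrow> l"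
    using compact_Icc[of "-K" K] unfolding compact_def by metis
  have late: "\<exists>n\<ge>N. T \<le> real (r n)" for T N
    using seq_suble[OF r(1)] by (metis nle_le of_nat_le_iff order_trans real_nat_ceiling_ge)
  have lo: "\<exists>t\<ge>T. z t < c" if "l < c" for c T
    using order_tendstoD(2)[OF r(2) that] late[of _ T] unfolding eventually_sequentially by fastforce
  have hi: "\<exists>t\<ge>T. c < z t" if "c < l" for c T
    using order_tendstoD(1)[OF r(2) that] late[of _ T] unfolding eventually_sequentially by fastforce
  show thesis
  proof (rule that[of l], rule order_tendstoI)
    fix a assume "a < l"
    have "\<not> (\<forall>T. \<exists>t\<ge>T. z t \<le> a)"
    proof
      assume *: "\<forall>T. \<exists>t\<ge>T. z t \<le> a"
      obtain c where "c \<in> {a<..<l}" "H c \<noteq> c" using isolated[OF \<open>a < l\<close>] by blast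
      then show False using fixed[of c] hi[of c] * by (meson greaterThanLessThan_iff order_le_less_trans)
    qed
    then show "\<forall>\<^sub>F t in at_top. a < z t" by (force simp: eventually_at_top_linorder)
  next
    fix a assume "l < a"
    have "\<not> (\<forall>T. \<exists>t\<ge>T. a \<le> z t)"
    proof
      assume *: "\<forall>T. \<exists>t\<ge>T. a \<le> z t"
      obtain c where "c \<in> {l<..<a}" "H c \<noteq> c" using isolated[OF \<open>l < a\<close>] by blast
      then show False using fixed[of c] lo[of c] * by (meson greaterThanLessThan_iff order_less_le_trans)
    qed
    then show "\<forall>\<^sub>F t in at_top. z t < a" by (force simp: eventually_at_top_linorder)
  qed
qed

text \<open>
  The two choices of \<open>\<tau>\<close> that matter are the identity, for the original equation, and the truncation to
  \<open>{-K..K}\<close>, for the modified equation from which solutions are constructed.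
\<close>

lemma relaxation_bounded:
  fixes f :: "real \<Rightarrow> real"
  assumes f: "\<And>t. 0 \<le> t \<Longrightarrow> (f has_real_derivative p t * (c t - \<tau> (f t))) (at t within {0..})"
    and p: "\<And>t. 0 \<le> p t" and c: "\<And>t. \<bar>c t\<bar> \<le> K"
    and \<tau>: "\<And>u. K \<le> u \<Longrightarrow> K \<le> \<tau> u" "\<And>u. u \<le> - K \<Longrightarrow> \<tau> u \<le> - K"
    and f0: "\<bar>f 0\<bar> \<le> K" and t: "0 \<le> t"
  shows "\<bar>f t\<bar> \<le> K"
proof -
  have "f t \<le> K"
  proof (rule upper_barrier[OF f _ _ t])
    show "p s * (c s - \<tau> (f s)) \<le> 0" if "K < f s" for s
      using p[of s] c[of s] \<tau>(1)[of "f s"] that by (intro mult_nonneg_nonpos) auto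
  qed (use f0 in auto)
  moreover have "- K \<le> f t"
  proof (rule lower_barrier[OF f _ _ t])
    show "0 \<le> p s * (c s - \<tau> (f s))" if "f s < - K" for s
      using p[of s] c[of s] \<tau>(2)[of "f s"] that by (intro mult_nonneg_nonneg) auto
  qed (use f0 in auto)
  ultimately show ?thesis by simp
qed

lemma tendsto_0_if_square_dominated:
  fixes f g :: "'a \<Rightarrow> real"
  assumes g: "(g \<longlongrightarrow> 0) F" and c: "0 < c" and le: "\<forall>\<^sub>F t in F. c * (f t)^2 \<le> g t"
  shows "(f \<longlongrightarrow> 0) F"
proof -
  have "((\<lambda>t. (f t)^2) \<longlongrightarrow> 0) F"
  proof (rule tendsto_sandwich[of "\<lambda>_. 0"])
    show "((\<lambda>t. g t / c) \<longlongrightarrow> 0) F" using tendsto_divide[OF g tendsto_const[of c]] c by simp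
    show "\<forall>\<^sub>F t in F. (f t)^2 \<le> g t / c"
      using le c by (auto elim!: eventually_mono simp: pos_le_divide_eq mult.commute)
  qed auto
  then have "((\<lambda>t. sqrt ((f t)^2)) \<longlongrightarrow> sqrt 0) F" by (rule tendsto_real_sqrt)
  then show ?thesis by (simp add: tendsto_rabs_zero_iff)
qed

section \<open>Lipschitz estimates\<close>

lemma lipschitz_on_mult_bounded:
  fixes f g :: "'a::metric_space \<Rightarrow> real"
  assumes f: "M-lipschitz_on S f" and g: "N-lipschitz_on S g"
    and bf: "\<And>x. x \<in> S \<Longrightarrow> \<bar>f x\<bar> \<le> A" and bg: "\<And>x. x \<in> S \<Longrightarrow> \<bar>g x\<bar> \<le> B"
    and AB: "0 \<le> A" "0 \<le> B"
  shows "(A * N + B * M)-lipschitz_on S (\<lambda>x. f x * g x)"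
proof (rule lipschitz_onI)
  show "0 \<le> A * N + B * M"
    using AB lipschitz_on_nonneg[OF f] lipschitz_on_nonneg[OF g] by simp
  fix x y assume xy: "x \<in> S" "y \<in> S"
  have "f x * g x - f y * g y = f x * (g x - g y) + g y * (f x - f y)" by (simp add: algebra_simps)
  then have "\<bar>f x * g x - f y * g y\<bar> \<le> \<bar>f x\<bar> * \<bar>g x - g y\<bar> + \<bar>g y\<bar> * \<bar>f x - f y\<bar>"
    by (metis abs_mult abs_triangle_ineq)
  also have "\<dots> \<le> A * (N * dist x y) + B * (M * dist x y)"
    using bf[OF xy(1)] bg[OF xy(2)] lipschitz_onD[OF f xy] lipschitz_onD[OF g xy] AB
    by (intro add_mono mult_mono) (auto simp: dist_real_def)
  finally show "dist (f x * g x) (f y * g y) \<le> (A * N + B * M) * dist x y"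
    by (simp add: dist_real_def algebra_simps)
qed

lemma lipschitz_on_vecI:
  fixes f :: "'a::metric_space \<Rightarrow> 'b::real_normed_vector ^ 'n"
  assumes "\<And>i. (L i)-lipschitz_on S (\<lambda>x. f x $ i)"
  shows "(\<Sum>i\<in>UNIV. L i)-lipschitz_on S f"
proof (rule lipschitz_onI)
  show "0 \<le> (\<Sum>i\<in>UNIV. L i)" using lipschitz_on_nonneg[OF assms] by (simp add: sum_nonneg)
  fix x y assume xy: "x \<in> S" "y \<in> S"
  have "dist (f x) (f y) = L2_set (\<lambda>i. dist (f x $ i) (f y $ i)) UNIV" by (simp add: dist_vec_def)
  also have "\<dots> \<le> (\<Sum>i\<in>UNIV. dist (f x $ i) (f y $ i))" by (rule L2_set_le_sum) simp
  also have "\<dots> \<le> (\<Sum>i\<in>UNIV. L i * dist x y)"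
    by (rule sum_mono) (rule lipschitz_onD[OF assms xy])
  finally show "dist (f x) (f y) \<le> (\<Sum>i\<in>UNIV. L i) * dist x y" by (simp add: sum_distrib_right)
qed

lemma lipschitz_on_component2: "1-lipschitz_on S (\<lambda>x :: 'a::real_normed_vector ^ 'm ^ 'n. x $ i $ r)"
proof (rule lipschitz_onI)
  fix x y :: "'a ^ 'm ^ 'n"
  have "norm ((x - y) $ i $ r) \<le> norm (x - y)" by (rule order_trans[OF Finite_Cartesian_Product.norm_nth_le Finite_Cartesian_Product.norm_nth_le])
  then show "dist (x $ i $ r) (y $ i $ r) \<le> 1 * dist x y" by (simp add: dist_norm)
qed simp

section \<open>The logistic function\<close>

definition sigmoid :: "real \<Rightarrow> real" where
  "sigmoid u = 1 / (1 + exp (- u))"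

lemma sigmoid_bounds: "0 < sigmoid u" "sigmoid u < 1"
  by (auto simp: sigmoid_def add_pos_pos field_simps)

lemma one_minus_sigmoid: "1 - sigmoid u = exp (- u) / (1 + exp (- u))"
proof -
  have "0 < 1 + exp (- u)" by (rule add_pos_pos) auto
  then show ?thesis unfolding sigmoid_def by (simp add: diff_divide_eq_iff)
qed

lemma sigmoid_minus: "sigmoid (- u) = 1 - sigmoid u"
proof -
  have e: "0 < exp (- u)" by simp
  have "exp (- u) / (1 + exp (- u)) = exp (- u) / (exp (- u) * (1 + exp u))"
    by (simp add: distrib_left add.commute flip: exp_add)
  also have "\<dots> = 1 / (1 + exp u)" using e by simp
  finally show ?thesis unfolding one_minus_sigmoid by (simp add: sigmoid_def)
qed

lemma DERIV_sigmoid: "(sigmoid has_real_derivative sigmoid u * (1 - sigmoid u)) (at u)"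
proof -
  have ne: "1 + exp (- u) \<noteq> 0" using add_pos_pos[of 1 "exp (- u)"] by simp
  have "((\<lambda>u. inverse (1 + exp (- u))) has_real_derivative
      - (inverse (1 + exp (- u)) * (exp (- u) * - 1) * inverse (1 + exp (- u)))) (at u)"
    by (rule derivative_eq_intros refl ne)+ simp
  then show ?thesis
    unfolding one_minus_sigmoid by (simp add: sigmoid_def[abs_def] divide_inverse mult_ac)
qed

lemma continuous_on_sigmoid [continuous_intros]:
  "continuous_on S f \<Longrightarrow> continuous_on S (\<lambda>x. sigmoid (f x))"
  using continuous_on_compose2[OF DERIV_continuous_on[of UNIV sigmoid], OF DERIV_sigmoid] by auto

lemma sigmoid_mono: "u \<le> v \<Longrightarrow> sigmoid u \<le> sigmoid v"
  by (auto simp: sigmoid_def add_pos_pos intro!: divide_left_mono)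

lemma lipschitz_on_sigmoid: "1-lipschitz_on S sigmoid"
proof (rule lipschitz_on_subset)
  show "1-lipschitz_on UNIV sigmoid"
  proof (rule bounded_derivative_imp_lipschitz)
    show "(sigmoid has_derivative (*) (sigmoid u * (1 - sigmoid u))) (at u)" for u
      using DERIV_sigmoid by (simp add: has_field_derivative_def)
    fix u
    have "\<bar>sigmoid u * (1 - sigmoid u)\<bar> \<le> 1"
      using sigmoid_bounds[of u] by (simp add: abs_mult mult_le_one)
    then have "norm (sigmoid u * (1 - sigmoid u) * v) \<le> 1 * norm v" for v
      using mult_right_mono[of "\<bar>sigmoid u * (1 - sigmoid u)\<bar>" 1 "\<bar>v\<bar>"] by (simp add: abs_mult)
    then show "onorm ((*) (sigmoid u * (1 - sigmoid u))) \<le> 1"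
      by (intro onorm_bound) auto
  qed auto
qed simp

lemma ln_odds_sigmoid: "ln (sigmoid u / (1 - sigmoid u)) = u"
proof -
  have e: "0 < exp (- u)" by simp
  have "sigmoid u / (1 - sigmoid u) = 1 / exp (- u)"
    using add_pos_pos[OF zero_less_one e] unfolding one_minus_sigmoid by (simp add: sigmoid_def)
  also have "\<dots> = exp u" by (simp add: exp_minus divide_inverse)
  finally show ?thesis by simp
qed

text \<open>
  Both \<open>ln v\<close> and \<open>- ln (1 - v)\<close> are increasing in \<open>v\<close>, the former with slope at least \<open>1\<close>.
\<close>

lemma ln_odds_gap:
  fixes u v :: real
  assumes "0 < u" "u \<le> v" "v < 1"
  shows "v - u \<le> ln (v / (1 - v)) - ln (u / (1 - u))"
proof -
  have "ln (u / v) \<le> u / v - 1" using assms by (intro ln_le_minus_one) auto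
  also have "\<dots> = (u - v) / v" using assms by (simp add: field_simps)
  also have "\<dots> \<le> u - v" using assms by (simp add: divide_le_eq mult_le_cancel_left1 mult_le_cancel_left2)
  finally have "v - u \<le> ln v - ln u" using assms by (simp add: ln_div)
  moreover have "ln (1 - v) \<le> ln (1 - u)" using assms by simp
  moreover have "ln (u / (1 - u)) = ln u - ln (1 - u)" "ln (v / (1 - v)) = ln v - ln (1 - v)"
    using assms by (auto simp: ln_div)
  ultimately show ?thesis by linarith
qed

section \<open>Fixed points of composed logistic responses\<close>

text \<open>
  Suppose the equation \<open>H x = x\<close> holds on an interval. Put \<open>s\<close> for the inner and \<open>r\<close> for the outer
  value of the logistic function, so that \<open>r = (x - c) / d\<close> is affine in \<open>x\<close>. As
  \<open>\<sigma>' = \<sigma> * (1 - \<sigma>)\<close>, differentiating once gives that \<open>s * (1 - s) * (r * (1 - r))\<close> is constant, and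
  differentiating this gives a second relation between \<open>s\<close> and \<open>r\<close>. Eliminating \<open>s\<close> through
  \<open>(1 - 2 * s)^2 = 1 - 4 * (s * (1 - s))\<close> leaves a polynomial equation for \<open>r\<close>, whose constant
  term is \<open>-1\<close>; it cannot hold for the infinitely many values of \<open>r\<close>.
\<close>

lemma response_fixed_points_isolated:
  fixes b1 b2 c d a b :: real
  assumes pos: "0 < b1" "0 < b2" "0 \<le> d" and ab: "a < b"
  shows "\<exists>x\<in>{a<..<b}. c + d * sigmoid (- b2 * (c + d * sigmoid (- b1 * x))) \<noteq> x"
proof (rule ccontr)
  assume "\<not> ?thesis"
  then have fp: "c + d * sigmoid (- b2 * (c + d * sigmoid (- b1 * x))) = x" if "x \<in> {a<..<b}" for x
    using that by auto
  have d: "0 < d"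
  proof (rule ccontr)
    assume "\<not> 0 < d"
    then have "d = 0" using pos by simp
    then have all_c: "x = c" if "x \<in> {a<..<b}" for x using fp[OF that] by simp
    obtain x where x: "a < x" "x < b" using dense[OF ab] by blast
    obtain y where y: "a < y" "y < x" using dense[OF x(1)] by blast
    show False using all_c[of x] all_c[of y] x y by simp
  qed
  define s where "s x = sigmoid (- b1 * x)" for x
  define r where "r x = sigmoid (- b2 * (c + d * s x))" for x
  have r_eq: "r x = (x - c) / d" if "x \<in> {a<..<b}" for x
    using fp[OF that] d by (simp add: r_def s_def field_simps)
  have s': "(s has_real_derivative - b1 * (s x * (1 - s x))) (at x)" for x
  proof -
    have "((\<lambda>x. - b1 * x) has_real_derivative - b1) (at x)"
      by (auto intro!: derivative_eq_intros)
    from DERIV_chain2[OF DERIV_sigmoid this] show ?thesis by (simp add: s_def[abs_def] mult_ac)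
  qed
  have r': "(r has_real_derivative r x * (1 - r x) * (b2 * d * (b1 * (s x * (1 - s x))))) (at x)" for x
  proof -
    have "((\<lambda>x. - b2 * (c + d * s x)) has_real_derivative b2 * d * (b1 * (s x * (1 - s x)))) (at x)"
      using s'[of x] by (auto intro!: derivative_eq_intros)
    from DERIV_chain2[OF DERIV_sigmoid this] show ?thesis by (simp add: r_def[abs_def])
  qed
  have r'_eq: "(r has_real_derivative 1 / d) (at x)" if "x \<in> {a<..<b}" for x
  proof -
    have "((\<lambda>x. (x - c) / d) has_real_derivative 1 / d) (at x)"
      using d by (auto intro!: derivative_eq_intros)
    then show ?thesis
      by (rule has_field_derivative_transform_within_open[OF _ open_greaterThanLessThan that]) (simp add: r_eq)
  qed
  define q where "q x = s x * (1 - s x) * (r x * (1 - r x))" for x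
  have q_eq: "q x = 1 / (d^2 * b1 * b2)" if "x \<in> {a<..<b}" for x
    using DERIV_unique[OF r' r'_eq[OF that]] d pos by (simp add: q_def field_simps power2_eq_square)
  have first: "d * b1 * (1 - 2 * s x) * (r x * (1 - r x)) = 1 - 2 * r x" if x: "x \<in> {a<..<b}" for x
  proof -
    have "(q has_real_derivative 0) (at x)"
      using DERIV_const[of "1 / (d^2 * b1 * b2)"]
      by (rule has_field_derivative_transform_within_open[OF _ open_greaterThanLessThan x]) (simp add: q_eq)
    moreover have "(q has_real_derivative s x * (1 - s x) / d *
        (1 - 2 * r x - d * b1 * (1 - 2 * s x) * (r x * (1 - r x)))) (at x)"
      unfolding q_def[abs_def] using s'[of x] r'_eq[OF x] d
      by (auto intro!: derivative_eq_intros simp: field_simps)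
    ultimately have "s x * (1 - s x) / d * (1 - 2 * r x - d * b1 * (1 - 2 * s x) * (r x * (1 - r x))) = 0"
      by (metis DERIV_unique)
    then show ?thesis using d sigmoid_bounds[of "- b1 * x"] by (simp add: s_def)
  qed
  \<comment> \<open>\<open>Y\<close> stands for \<open>r * (1 - r)\<close>, and \<open>P\<close> is the polynomial in \<open>r\<close> that is left after elimination.\<close>
  define k where "k = b1 / b2"
  have k: "b1 = k * b2" using pos by (simp add: k_def)
  define Y :: "real poly" where "Y = [:0, 1, -1:]"
  define P :: "real poly" where "P = smult (d^2 * b1^2) (Y * Y) + smult (4 - 4 * k) Y - 1"
  have root: "poly P (r x) = 0" if x: "x \<in> {a<..<b}" for x
  proof -
    define y where "y = r x * (1 - r x)"
    define v where "v = s x * (1 - s x)"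
    have vy: "v * y * (d^2 * b1 * b2) = 1"
      using q_eq[OF x] d pos by (simp add: q_def v_def y_def field_simps)
    have "d^2 * b1^2 * (1 - 4 * v) * y^2 = (d * b1 * (1 - 2 * s x) * y)^2"
      unfolding v_def by algebra
    also have "\<dots> = (1 - 2 * r x)^2" unfolding y_def first[OF x] ..
    also have "\<dots> = 1 - 4 * y" unfolding y_def by algebra
    finally have sq: "d^2 * b1^2 * (1 - 4 * v) * y^2 = 1 - 4 * y" .
    have "d^2 * b1^2 * (1 - 4 * v) * y^2 = d^2 * b1^2 * y^2 - 4 * k * y * (v * y * (d^2 * b1 * b2))"
      unfolding k by (simp add: power2_eq_square algebra_simps)
    then have "d^2 * b1^2 * y^2 + (4 - 4 * k) * y - 1 = 0"
      using sq unfolding vy by (simp add: algebra_simps)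
    moreover have "poly P (r x) = d^2 * b1^2 * y^2 + (4 - 4 * k) * y - 1"
      by (simp add: P_def Y_def y_def power2_eq_square algebra_simps)
    ultimately show ?thesis by simp
  qed
  have "poly P 0 = -1" by (simp add: P_def Y_def)
  then have "P \<noteq> 0" by auto
  then have "finite {t. poly P t = 0}" by (rule poly_roots_finite)
  moreover have "(\<lambda>x. (x - c) / d) ` {a<..<b} \<subseteq> {t. poly P t = 0}"
    using root r_eq by auto
  ultimately have "finite ((\<lambda>x. (x - c) / d) ` {a<..<b})" by (rule finite_subset[rotated])
  moreover have "inj_on (\<lambda>x. (x - c) / d) {a<..<b}" using d by (auto simp: inj_on_def)
  ultimately show False using infinite_Ioo[OF ab] finite_image_iff by blast
qed

section \<open>The potential of a single route\<close>

text \<open>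
  The function \<open>w'\<close> inverts the travel time \<open>\<zeta> \<mapsto> C + d * sigmoid (b * \<zeta>)\<close> for \<open>\<bar>\<zeta>\<bar> \<le> Z\<close>, and the last
  inequality says that it does so monotonically, with a uniform slope. Orbits may start at \<open>x\<close> that
  are not travel times, so the inverse, which is the log-odds function up to scaling, is extended
  with a positive slope beyond the range of the travel time.

  If \<open>d = 0\<close>, the travel time is the constant \<open>C\<close> and has no inverse. The monotone substitute would
  jump at \<open>C\<close> from below \<open>- Z\<close> to above \<open>Z\<close>; on a set \<open>X\<close> that lies on one side of \<open>C\<close> it can be taken
  constant. This is the role of the assumption \<open>side\<close>.
\<close>

lemma route_potential_exists:
  fixes b d C K Z :: real and X :: "real set"
  assumes b: "0 < b" and d: "0 \<le> d" and Z: "0 \<le> Z"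
    and X: "X \<subseteq> {-K..K}" and C: "C \<in> {-K..K}" and K: "0 < K"
    and side: "d = 0 \<Longrightarrow> (\<forall>x\<in>X. C \<le> x) \<or> (\<forall>x\<in>X. x \<le> C)"
  obtains w w' k where "0 < k"
    and "\<And>x. x \<in> X \<Longrightarrow> (w has_real_derivative w' x) (at x)"
    and "\<And>x \<zeta>. x \<in> X \<Longrightarrow> \<bar>\<zeta>\<bar> \<le> Z \<Longrightarrow>
           k * (x - (C + d * sigmoid (b * \<zeta>)))^2 \<le> (w' x - \<zeta>) * (x - (C + d * sigmoid (b * \<zeta>)))"
proof (cases "d = 0")
  case True
  obtain s :: real where s: "s = 1 \<or> s = -1" "\<And>x. x \<in> X \<Longrightarrow> 0 \<le> s * (x - C)"
  proof -
    from side[OF True] show thesis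
    proof
      assume "\<forall>x\<in>X. C \<le> x" then show thesis using that[of 1] by simp
    next
      assume "\<forall>x\<in>X. x \<le> C" then show thesis using that[of "-1"] by simp
    qed
  qed
  show thesis
  proof (rule that[of "1 / (2 * K)" "\<lambda>x. s * (Z + 1) * x" "\<lambda>x. s * (Z + 1)"])
    show "0 < 1 / (2 * K)" using K by simp
    show "((\<lambda>x. s * (Z + 1) * x) has_real_derivative s * (Z + 1)) (at x)" for x
      by (auto intro!: derivative_eq_intros)
    fix x \<zeta> assume x: "x \<in> X" and z: "\<bar>\<zeta>\<bar> \<le> Z"
    define y where "y = s * (x - C)"
    have y: "0 \<le> y" "y \<le> 2 * K" "x - C = s * y"
      using s(2)[OF x] s(1) X C x by (auto simp: y_def)
    have "1 / (2 * K) * (x - C)^2 = y * (y / (2 * K))"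
      using s(1) y(3) by (auto simp: power2_eq_square)
    also have "\<dots> \<le> y * 1" using y K by (intro mult_left_mono) (auto simp: divide_le_eq)
    also have "\<dots> \<le> y * (Z + 1 - s * \<zeta>)" using y(1) z s(1) by (intro mult_left_mono) auto
    also have "\<dots> = (s * (Z + 1) - \<zeta>) * (x - C)" using s(1) y(3) by (auto simp: algebra_simps)
    finally show "1 / (2 * K) * (x - (C + d * sigmoid (b * \<zeta>)))^2
        \<le> (s * (Z + 1) - \<zeta>) * (x - (C + d * sigmoid (b * \<zeta>)))" by (simp add: True)
  qed
next
  case False
  with d have d: "0 < d" by simp
  define e where "e = sigmoid (- (b * Z))"
  have e: "0 < e" "e \<le> 1 - e"
    using sigmoid_bounds[of "- (b * Z)"] sigmoid_mono[of "- (b * Z)" "b * Z"] sigmoid_minus[of "b * Z"] b Z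
    by (auto simp: e_def)
  \<comment> \<open>The log-odds are cut off at the extreme values of \<open>sigmoid (b * \<zeta>)\<close> for \<open>\<bar>\<zeta>\<bar> \<le> Z\<close>; the term \<open>y - cl y\<close> vanishes there and provides the slope outside.\<close>
  define cl where "cl y = max e (min y (1 - e))" for y
  have cl: "0 < cl y" "cl y < 1" for y using e by (auto simp: cl_def)
  define \<omega> where "\<omega> y = ln (cl y / (1 - cl y)) / b + (y - cl y)" for y
  define m where "m = min (1 / b) 1"
  have m: "0 < m" "m \<le> 1 / b" "m \<le> 1" using b by (auto simp: m_def)
  have mono: "m * (v - u) \<le> \<omega> v - \<omega> u" if "u \<le> v" for u v
  proof -
    have c: "cl u \<le> cl v" "cl v - cl u \<le> v - u" using that by (auto simp: cl_def)
    have "m * (v - u) = m * (cl v - cl u) + m * ((v - u) - (cl v - cl u))" by (simp add: algebra_simps)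
    also have "\<dots> \<le> (1 / b) * (cl v - cl u) + 1 * ((v - u) - (cl v - cl u))"
      using m c by (intro add_mono mult_right_mono) auto
    also have "\<dots> \<le> (1 / b) * (ln (cl v / (1 - cl v)) - ln (cl u / (1 - cl u))) + 1 * ((v - u) - (cl v - cl u))"
      using ln_odds_gap[OF cl(1) c(1) cl(2)] b by (intro add_mono mult_left_mono) auto
    also have "\<dots> = \<omega> v - \<omega> u" by (simp add: \<omega>_def algebra_simps diff_divide_distrib)
    finally show ?thesis .
  qed
  have at_sigmoid: "\<omega> (sigmoid (b * \<zeta>)) = \<zeta>" if "\<bar>\<zeta>\<bar> \<le> Z" for \<zeta>
  proof -
    have "b * - Z \<le> b * \<zeta>" "b * \<zeta> \<le> b * Z"
      using that b by (intro mult_left_mono; simp)+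
    then have "e \<le> sigmoid (b * \<zeta>)" "sigmoid (b * \<zeta>) \<le> 1 - e"
      using sigmoid_mono[of "- (b * Z)" "b * \<zeta>"] sigmoid_mono[of "b * \<zeta>" "b * Z"] sigmoid_minus[of "b * Z"]
      by (simp_all add: e_def)
    then have "cl (sigmoid (b * \<zeta>)) = sigmoid (b * \<zeta>)" by (simp add: cl_def)
    then show ?thesis using b by (simp add: \<omega>_def ln_odds_sigmoid)
  qed
  define w' where "w' x = \<omega> ((x - C) / d)" for x
  have "continuous_on UNIV cl" unfolding cl_def by (intro continuous_intros)
  then have "continuous_on UNIV \<omega>"
    using cl less_imp_neq[OF cl(1)] less_imp_neq[OF cl(2)] b unfolding \<omega>_def
    by (intro continuous_intros) auto
  then have "continuous_on {-K - 1..K + 1} w'"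
    unfolding w'_def by (rule continuous_on_compose2) (use d in \<open>auto intro!: continuous_intros\<close>)
  \<comment> \<open>The interval is larger than \<open>{-K..K}\<close> so that \<open>X\<close> lies in its interior.\<close>
  then obtain w where w: "\<And>x. x \<in> {-K - 1..K + 1} \<Longrightarrow> (w has_vector_derivative w' x) (at x within {-K - 1..K + 1})"
    using antiderivative_continuous[of "-K - 1" "K + 1" w'] by blast
  show thesis
  proof (rule that[of "m / d" w w'])
    show "0 < m / d" using m d by simp
    show "(w has_real_derivative w' x) (at x)" if "x \<in> X" for x
    proof -
      have x: "x \<in> {-K - 1<..<K + 1}" using that X by auto
      then have "at x within {-K - 1..K + 1} = at x"
        by (intro at_within_interior) (simp add: interior_atLeastAtMost_real)
      then show ?thesis
        using w[of x] x by (simp add: has_real_derivative_iff_has_vector_derivative)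
    qed
    fix x \<zeta> assume x: "x \<in> X" and z: "\<bar>\<zeta>\<bar> \<le> Z"
    define u where "u = (x - C) / d"
    define v where "v = sigmoid (b * \<zeta>)"
    have uv: "x - (C + d * v) = d * (u - v)" using d by (simp add: u_def field_simps)
    have "m * (u - v)^2 \<le> (\<omega> u - \<omega> v) * (u - v)"
    proof (cases "v \<le> u")
      case True
      from mult_right_mono[OF mono[OF True], of "u - v"] True show ?thesis
        by (simp add: power2_eq_square)
    next
      case False
      then have "u \<le> v" by simp
      from mult_right_mono[OF mono[OF this], of "v - u"] this show ?thesis
        by (simp add: power2_eq_square algebra_simps)
    qed
    then have "d * (m * (u - v)^2) \<le> d * ((\<omega> u - \<omega> v) * (u - v))"
      using d by (intro mult_left_mono) auto
    moreover have "m / d * (d * (u - v))^2 = d * (m * (u - v)^2)"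
      using d by (simp add: power2_eq_square)
    moreover have "w' x - \<zeta> = \<omega> u - \<omega> v"
      using at_sigmoid[OF z] by (simp add: w'_def u_def v_def)
    ultimately show "m / d * (x - (C + d * sigmoid (b * \<zeta>)))^2 \<le> (w' x - \<zeta>) * (x - (C + d * sigmoid (b * \<zeta>)))"
      unfolding v_def[symmetric] uv by (simp add: mult_ac)
  qed
qed

section \<open>Invariant cubes and the flow\<close>

lemma other_simps [simp]: "other 1 = 2" "other 2 = 1"
  by (auto simp: other_def)

lemma logit_eq_sigmoid: "logit b y r = sigmoid (b * (y $ other r - y $ r))"
proof -
  have "logit b y r = exp (- b * y $ r) / (exp (- b * y $ r) + exp (- b * y $ other r))"
    using exhaust_2[of r] by (auto simp: logit_def add.commute)
  also have "\<dots> = exp (- b * y $ r) / (exp (- b * y $ r) * (1 + exp (- (b * (y $ other r - y $ r)))))"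
    by (simp add: distrib_left algebra_simps flip: exp_add)
  also have "\<dots> = sigmoid (b * (y $ other r - y $ r))" by (simp add: sigmoid_def)
  finally show ?thesis .
qed

text \<open>
  For large \<open>K\<close> this is a positively invariant set; the union over \<open>K\<close> exhausts the state space.
\<close>

definition cube :: "real \<Rightarrow> state set" where
  "cube K = {x. \<forall>i r. \<bar>x $ i $ r\<bar> \<le> K}"

lemma cubeI: "(\<And>i r. \<bar>x $ i $ r\<bar> \<le> K) \<Longrightarrow> x \<in> cube K"
  and cubeD: "x \<in> cube K \<Longrightarrow> \<bar>x $ i $ r\<bar> \<le> K"
  by (auto simp: cube_def)

lemma compact_cube: "compact (cube K)"
proof -
  have "norm x \<le> (\<Sum>i::2\<in>UNIV. \<Sum>r::2\<in>UNIV. K)" if "x \<in> cube K" for x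
  proof -
    have "norm x \<le> (\<Sum>i\<in>UNIV. norm (x $ i))"
      unfolding norm_vec_def by (rule L2_set_le_sum) simp
    also have "\<dots> \<le> (\<Sum>i\<in>UNIV. \<Sum>r\<in>UNIV. norm (x $ i $ r))"
      unfolding norm_vec_def[of "x $ i" for i] by (intro sum_mono L2_set_le_sum) simp
    also have "\<dots> \<le> (\<Sum>i::2\<in>UNIV. \<Sum>r::2\<in>UNIV. K)"
      using cubeD[OF that] by (intro sum_mono) simp
    finally show ?thesis .
  qed
  then have "bounded (cube K)" by (auto simp: bounded_iff)
  moreover have "closed (cube K)"
    unfolding cube_def by (intro closed_Collect_all closed_Collect_le continuous_intros)
  ultimately show ?thesis by (simp add: compact_eq_bounded_closed)
qed

definition trunc :: "real \<Rightarrow> state \<Rightarrow> state" where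
  "trunc K x = (\<chi> i r. max (- K) (min K (x $ i $ r)))"

lemma trunc_component: "trunc K x $ i $ r = max (- K) (min K (x $ i $ r))"
  by (simp add: trunc_def)

lemma trunc_in_cube: "0 \<le> K \<Longrightarrow> trunc K x \<in> cube K"
  by (rule cubeI) (auto simp: trunc_def)

lemma trunc_id:
  assumes "x \<in> cube K"
  shows "trunc K x = x"
proof -
  have "max (- K) (min K u) = u" if "\<bar>u\<bar> \<le> K" for u :: real using that by auto
  from this[OF cubeD[OF assms]] show ?thesis by (simp add: vec_eq_iff trunc_component)
qed

lemma lipschitz_on_trunc: "4-lipschitz_on UNIV (trunc K)"
proof -
  have "1-lipschitz_on UNIV (\<lambda>x. trunc K x $ i $ r)" for i r
  proof (rule lipschitz_onI)
    fix x y :: state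
    have "\<bar>trunc K x $ i $ r - trunc K y $ i $ r\<bar> \<le> \<bar>x $ i $ r - y $ i $ r\<bar>"
      by (auto simp: trunc_def max_def min_def)
    also have "\<dots> \<le> dist x y"
      using lipschitz_onD[OF lipschitz_on_component2[of UNIV i r], of x y] by (simp add: dist_real_def)
    finally show "dist (trunc K x $ i $ r) (trunc K y $ i $ r) \<le> 1 * dist x y" by (simp add: dist_real_def)
  qed simp
  then have "(\<Sum>i::2\<in>UNIV. \<Sum>r::2\<in>UNIV. 1)-lipschitz_on UNIV (trunc K)"
    by (intro lipschitz_on_vecI)
  then show ?thesis by (simp add: sum_2)
qed

locale traffic_game =
  fixes \<beta> :: "player \<Rightarrow> real" and C1 C2 :: "route \<Rightarrow> real"
  assumes \<beta>_pos: "\<And>i. 0 < \<beta> i" and C_le: "\<And>r. C1 r \<le> C2 r"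
begin

lemma cost_eq:
  "cost \<beta> C1 C2 i r y = C1 r + (C2 r - C1 r) * sigmoid (\<beta> (other i) * (y $ other r - y $ r))"
  by (simp add: cost_def logit_eq_sigmoid)

lemma cost_bounds: "C1 r \<le> cost \<beta> C1 C2 i r y" "cost \<beta> C1 C2 i r y \<le> C2 r"
proof -
  let ?s = "sigmoid (\<beta> (other i) * (y $ other r - y $ r))"
  have s: "0 \<le> ?s" "?s \<le> 1" and d: "0 \<le> C2 r - C1 r"
    using sigmoid_bounds[of "\<beta> (other i) * (y $ other r - y $ r)"] C_le[of r] by simp_all
  have "0 \<le> (C2 r - C1 r) * ?s" "(C2 r - C1 r) * ?s \<le> (C2 r - C1 r) * 1"
    using s d by (simp_all add: mult_left_le)
  then show "C1 r \<le> cost \<beta> C1 C2 i r y" "cost \<beta> C1 C2 i r y \<le> C2 r"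
    by (simp_all add: cost_eq)
qed

definition cost_bound :: real where
  "cost_bound = (\<Sum>r\<in>UNIV. \<bar>C1 r\<bar> + \<bar>C2 r\<bar>)"

lemma abs_C_le: "\<bar>C1 r\<bar> + \<bar>C2 r\<bar> \<le> cost_bound"
  unfolding cost_bound_def by (rule member_le_sum) auto

lemma abs_C1_le: "\<bar>C1 r\<bar> \<le> cost_bound"
  using abs_C_le[of r] abs_ge_zero[of "C2 r"] by linarith

lemma abs_cost_le: "\<bar>cost \<beta> C1 C2 i r y\<bar> \<le> cost_bound"
  using cost_bounds(1)[of r i y] cost_bounds(2)[of i r y] abs_C_le[of r] by linarith

lemma mean_field_component:
  "mean_field \<beta> C1 C2 x $ i $ r =
     sigmoid (\<beta> i * (x $ i $ other r - x $ i $ r)) * (cost \<beta> C1 C2 i r (x $ other i) - x $ i $ r)"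
  by (simp add: mean_field_def logit_eq_sigmoid)

text \<open>
  The bound depends on \<open>K\<close>: the derivative of the choice probability is multiplied by the distance
  to the travel time, so the field is not globally Lipschitz.
\<close>

lemma mean_field_lipschitz_on_cube: "\<exists>L. L-lipschitz_on (cube K) (mean_field \<beta> C1 C2)"
proof -
  have gap: "2-lipschitz_on S (\<lambda>x :: state. x $ i $ r - x $ i $ s)" for S i r s
    using lipschitz_on_diff[OF lipschitz_on_component2 lipschitz_on_component2, of S i r i s] by simp
  have sig: "(1 * (\<bar>b\<bar> * 2))-lipschitz_on S (\<lambda>x :: state. sigmoid (b * (x $ i $ r - x $ i $ s)))" for S i r s b
    by (rule lipschitz_on_compose2[OF lipschitz_on_cmult_real[OF gap] lipschitz_on_sigmoid])
  have cost: "\<exists>M. M-lipschitz_on S (\<lambda>x. cost \<beta> C1 C2 i r (x $ other i) - x $ i $ r)" for S i r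
    unfolding cost_eq
    by (rule exI, rule lipschitz_on_diff[OF lipschitz_on_add[OF lipschitz_on_constant
          lipschitz_on_cmult_real[OF sig]] lipschitz_on_component2])
  have "\<exists>M. M-lipschitz_on (cube K) (\<lambda>x. mean_field \<beta> C1 C2 x $ i $ r)" for i r
  proof -
    obtain M where M: "M-lipschitz_on (cube K) (\<lambda>x. cost \<beta> C1 C2 i r (x $ other i) - x $ i $ r)"
      using cost by blast
    have "(1 * M + (cost_bound + \<bar>K\<bar>) * (1 * (\<bar>\<beta> i\<bar> * 2)))-lipschitz_on (cube K)
        (\<lambda>x. sigmoid (\<beta> i * (x $ i $ other r - x $ i $ r)) * (cost \<beta> C1 C2 i r (x $ other i) - x $ i $ r))"
    proof (rule lipschitz_on_mult_bounded[OF sig M])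
      fix x assume x: "x \<in> cube K"
      show "\<bar>sigmoid (\<beta> i * (x $ i $ other r - x $ i $ r))\<bar> \<le> 1"
        using sigmoid_bounds[of "\<beta> i * (x $ i $ other r - x $ i $ r)"] by simp
      show "\<bar>cost \<beta> C1 C2 i r (x $ other i) - x $ i $ r\<bar> \<le> cost_bound + \<bar>K\<bar>"
        using abs_cost_le[of i r "x $ other i"] cubeD[OF x, of i r] by linarith
    qed (use abs_C1_le[of r] in auto)
    then show ?thesis unfolding mean_field_component by blast
  qed
  then obtain M where M: "\<And>i r. (M i r)-lipschitz_on (cube K) (\<lambda>x. mean_field \<beta> C1 C2 x $ i $ r)"
    by metis
  have "(\<Sum>i\<in>UNIV. \<Sum>r\<in>UNIV. M i r)-lipschitz_on (cube K) (mean_field \<beta> C1 C2)"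
    by (intro lipschitz_on_vecI M)
  then show ?thesis by blast
qed

lemma solution_component:
  assumes "solution_from \<beta> C1 C2 x0 x" "0 \<le> t"
  shows "((\<lambda>t. x t $ i $ r) has_real_derivative sigmoid (\<beta> i * (x t $ i $ other r - x t $ i $ r)) *
           (cost \<beta> C1 C2 i r (x t $ other i) - x t $ i $ r)) (at t within {0..})"
  using assms unfolding solution_from_def has_real_derivative_iff_has_vector_derivative
    mean_field_component[symmetric]
  by (auto intro!: bounded_linear.has_vector_derivative[OF bounded_linear_vec_nth])

lemma solution_in_cube:
  assumes x: "solution_from \<beta> C1 C2 x0 x" and x0: "x0 \<in> cube K" and K: "cost_bound \<le> K" and t: "0 \<le> t"
  shows "x t \<in> cube K"
proof (rule cubeI)
  fix i r
  show "\<bar>x t $ i $ r\<bar> \<le> K"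
  proof (rule relaxation_bounded[of "\<lambda>t. x t $ i $ r" _ _ "\<lambda>u. u", OF solution_component[OF x] _ _ _ _ _ t])
    show "\<bar>cost \<beta> C1 C2 i r (x s $ other i)\<bar> \<le> K" for s by (rule order_trans[OF abs_cost_le K])
    show "\<bar>x 0 $ i $ r\<bar> \<le> K" using x cubeD[OF x0] by (simp add: solution_from_def)
    show "0 \<le> sigmoid (\<beta> i * (x s $ i $ other r - x s $ i $ r))" for s
      using sigmoid_bounds(1) by (rule less_imp_le)
  qed auto
qed

text \<open>
  On the cube the field agrees with its composition with \<open>trunc K\<close>, which is bounded and Lipschitz
  everywhere. Truncation keeps the sign of the velocity at the faces of the cube, so solutions of the
  truncated equation do not leave the cube and therefore solve the original one.
\<close>

lemma solution_exists:
  assumes x0: "x0 \<in> cube K" and K: "cost_bound \<le> K"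
  shows "\<exists>x. solution_from \<beta> C1 C2 x0 x"
proof -
  have K0: "0 \<le> K" using cubeD[OF x0, of 1 1] by linarith
  obtain L where L: "L-lipschitz_on (cube K) (mean_field \<beta> C1 C2)"
    using mean_field_lipschitz_on_cube by blast
  define F where "F x = mean_field \<beta> C1 C2 (trunc K x)" for x
  have "L-lipschitz_on (trunc K ` UNIV) (mean_field \<beta> C1 C2)"
    by (rule lipschitz_on_subset[OF L]) (use trunc_in_cube[OF K0] in auto)
  then have F_lip: "(L * 4)-lipschitz_on UNIV F"
    unfolding F_def[abs_def] by (rule lipschitz_on_compose2[OF lipschitz_on_trunc])
  have "bounded (mean_field \<beta> C1 C2 ` cube K)"
    by (intro compact_imp_bounded compact_continuous_image lipschitz_on_continuous_on[OF L] compact_cube)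
  then obtain B where B: "\<And>x. x \<in> cube K \<Longrightarrow> norm (mean_field \<beta> C1 C2 x) \<le> B"
    by (auto simp: bounded_iff)
  have F_bound: "norm (F x) \<le> B" for x unfolding F_def by (rule B[OF trunc_in_cube[OF K0]])
  obtain x where x: "x 0 = x0" "\<And>t. 0 \<le> t \<Longrightarrow> (x has_vector_derivative F (x t)) (at t within {0..})"
    using lipschitz_ode_solution_exists[OF F_lip F_bound, of x0] by blast
  have "x t \<in> cube K" if t: "0 \<le> t" for t
  proof (rule cubeI)
    fix i r
    have "((\<lambda>t. x t $ i $ r) has_real_derivative F (x t) $ i $ r) (at t within {0..})" if "0 \<le> t" for t
      unfolding has_real_derivative_iff_has_vector_derivative
      using x(2)[OF that] by (intro bounded_linear.has_vector_derivative[OF bounded_linear_vec_nth])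
    then have der: "((\<lambda>t. x t $ i $ r) has_real_derivative
        sigmoid (\<beta> i * (trunc K (x t) $ i $ other r - trunc K (x t) $ i $ r)) *
          (cost \<beta> C1 C2 i r (trunc K (x t) $ other i) - max (- K) (min K (x t $ i $ r)))) (at t within {0..})"
      if "0 \<le> t" for t
      using that unfolding F_def mean_field_component trunc_component[of K "x t" i r, symmetric] .
    show "\<bar>x t $ i $ r\<bar> \<le> K"
    proof (rule relaxation_bounded[of "\<lambda>t. x t $ i $ r" _ _ "\<lambda>u. max (- K) (min K u)", OF der _ _ _ _ _ t])
      show "\<bar>cost \<beta> C1 C2 i r (trunc K (x s) $ other i)\<bar> \<le> K" for s by (rule order_trans[OF abs_cost_le K])
      show "\<bar>x 0 $ i $ r\<bar> \<le> K" using x(1) cubeD[OF x0] by simp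
      show "0 \<le> sigmoid (\<beta> i * (trunc K (x s) $ i $ other r - trunc K (x s) $ i $ r))" for s
        using sigmoid_bounds(1) by (rule less_imp_le)
    qed (use K0 in auto)
  qed
  then have "solution_from \<beta> C1 C2 x0 x"
    using x by (auto simp: solution_from_def F_def trunc_id)
  then show ?thesis by blast
qed

lemma flow_is_bounded_solution:
  obtains x K where "solution_from \<beta> C1 C2 x0 x" "cost_bound \<le> K" "0 < K"
    "\<And>t. 0 \<le> t \<Longrightarrow> x t \<in> cube K" "\<And>t. 0 \<le> t \<Longrightarrow> flow \<beta> C1 C2 t x0 = x t"
proof -
  define K where "K = cost_bound + norm x0 + 1"
  have cb: "0 \<le> cost_bound" using abs_C1_le[of 1] by linarith
  have K: "cost_bound \<le> K" "0 < K" using cb norm_ge_zero[of x0] by (auto simp: K_def intro: add_nonneg_pos)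
  have x0: "x0 \<in> cube K"
  proof (rule cubeI)
    fix i r
    have "\<bar>x0 $ i $ r\<bar> \<le> norm x0"
      by (rule order_trans[OF component_le_norm_cart Finite_Cartesian_Product.norm_nth_le])
    then show "\<bar>x0 $ i $ r\<bar> \<le> K" using cb by (simp add: K_def)
  qed
  obtain x where x: "solution_from \<beta> C1 C2 x0 x" using solution_exists[OF x0 K(1)] by blast
  obtain L where L: "L-lipschitz_on (cube K) (mean_field \<beta> C1 C2)"
    using mean_field_lipschitz_on_cube by blast
  have unique: "y t = x t" if y: "solution_from \<beta> C1 C2 x0 y" and t: "0 \<le> t" for y t
  proof (rule lipschitz_ode_solution_unique[OF L, of y x t])
    show "y s \<in> cube K" "x s \<in> cube K" if "0 \<le> s" for s
      using solution_in_cube[OF y x0 K(1) that] solution_in_cube[OF x x0 K(1) that] .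
  qed (use x y t in \<open>auto simp: solution_from_def\<close>)
  have flow: "flow \<beta> C1 C2 t x0 = x t" if "0 \<le> t" for t
    unfolding flow_def
  proof (rule the_equality)
    show "\<exists>y. solution_from \<beta> C1 C2 x0 y \<and> y t = x t" using x by blast
    show "z = x t" if "\<exists>y. solution_from \<beta> C1 C2 x0 y \<and> y t = z" for z
      using unique[OF _ \<open>0 \<le> t\<close>] that by auto
  qed
  show thesis
    by (rule that[OF x K solution_in_cube[OF x x0 K(1)] flow])
qed

section \<open>The Lyapunov function and convergence\<close>

context
  fixes x0 :: state and x :: "real \<Rightarrow> state" and K :: real
  assumes x: "solution_from \<beta> C1 C2 x0 x" and K: "cost_bound \<le> K" "0 < K"
    and in_cube: "\<And>t. 0 \<le> t \<Longrightarrow> x t \<in> cube K"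
begin

definition delay :: "player \<Rightarrow> route \<Rightarrow> real \<Rightarrow> real" where
  "delay i r t = x t $ i $ r"

definition gap :: "player \<Rightarrow> route \<Rightarrow> real \<Rightarrow> real" where
  "gap i r t = delay i (other r) t - delay i r t"

definition target :: "player \<Rightarrow> route \<Rightarrow> real \<Rightarrow> real" where
  "target i r t = C1 r + (C2 r - C1 r) * sigmoid (\<beta> (other i) * gap (other i) r t)"

definition rate :: "player \<Rightarrow> route \<Rightarrow> real \<Rightarrow> real" where
  "rate i r t = sigmoid (\<beta> i * gap i r t)"

lemma target_eq_cost: "target i r t = cost \<beta> C1 C2 i r (x t $ other i)"
  by (simp add: target_def cost_eq gap_def delay_def)

lemma DERIV_delay:
  "0 \<le> t \<Longrightarrow> (delay i r has_real_derivative rate i r t * (target i r t - delay i r t)) (at t within {0..})"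
  using solution_component[OF x] unfolding target_eq_cost rate_def gap_def delay_def[abs_def] by simp

lemma abs_delay_le: "0 \<le> t \<Longrightarrow> \<bar>delay i r t\<bar> \<le> K"
  unfolding delay_def by (rule cubeD[OF in_cube])

lemma abs_gap_le: "0 \<le> t \<Longrightarrow> \<bar>gap i r t\<bar> \<le> 2 * K"
  using abs_delay_le[of t i r] abs_delay_le[of t i "other r"] by (simp add: gap_def)

text \<open>
  On the cube, a player whose parameter is at most \<open>\<beta> 1 + \<beta> 2\<close> chooses every route at least with
  this probability.
\<close>

definition min_rate :: real where
  "min_rate = sigmoid (- ((\<beta> 1 + \<beta> 2) * (2 * K)))"

lemma min_rate_pos: "0 < min_rate" by (simp add: min_rate_def sigmoid_bounds)

lemma rate_ge:
  assumes t: "0 \<le> t"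
  shows "min_rate \<le> rate i r t"
  unfolding min_rate_def rate_def
proof (rule sigmoid_mono)
  have "\<beta> i \<le> (\<Sum>j\<in>UNIV. \<beta> j)" using \<beta>_pos by (intro member_le_sum) (auto intro: less_imp_le)
  then have b: "\<beta> i \<le> \<beta> 1 + \<beta> 2" by (simp only: sum_2)
  have "- (\<beta> i * gap i r t) \<le> \<bar>\<beta> i * gap i r t\<bar>" by (rule abs_ge_minus_self)
  also have "\<dots> = \<beta> i * \<bar>gap i r t\<bar>" using \<beta>_pos[of i] by (simp add: abs_mult)
  also have "\<dots> \<le> (\<beta> 1 + \<beta> 2) * (2 * K)"
    using b abs_gap_le[OF t] \<beta>_pos[of i] by (intro mult_mono) auto
  finally show "- ((\<beta> 1 + \<beta> 2) * (2 * K)) \<le> \<beta> i * gap i r t" by simp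
qed

text \<open>
  The potential of a route, read along the orbit. If \<open>C1 r = C2 r\<close>, the delay relaxes to a constant
  and never crosses it, so it stays on the side on which it starts.
\<close>

lemma route_potential:
  "\<exists>w w' k m. 0 < k
     \<and> (\<forall>t\<ge>0. (w has_real_derivative w' (delay i r t)) (at (delay i r t)))
     \<and> (\<forall>t\<ge>0. k * (delay i r t - target i r t)^2
              \<le> (w' (delay i r t) - gap (other i) r t) * (delay i r t - target i r t))
     \<and> (\<forall>t\<ge>0. m \<le> w (delay i r t))"
proof -
  \<comment> \<open>A compact set containing all values of the delay, so that \<open>w\<close> is bounded below on it.\<close>
  define X where "X = (if C1 r < C2 r then {-K..K} else if delay i r 0 \<le> C1 r then {-K..C1 r} else {C1 r..K})"
  have C: "C1 r \<in> {-K..K}" using abs_C1_le[of r] K by auto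
  have d: "0 \<le> C2 r - C1 r" using C_le[of r] by simp
  have in_X: "delay i r t \<in> X" if t: "0 \<le> t" for t
  proof -
    have K': "- K \<le> delay i r t" "delay i r t \<le> K" using abs_delay_le[OF t, of i r] by auto
    show ?thesis
    proof (cases "C1 r < C2 r")
      case True
      then show ?thesis using K' by (simp add: X_def)
    next
      case False
      then have const: "target i r s = C1 r" for s using C_le[of r] by (simp add: target_def)
      note der = DERIV_delay[of _ i r, unfolded const]
      have rate: "0 \<le> rate i r s" for s using sigmoid_bounds(1) unfolding rate_def by (rule less_imp_le)
      show ?thesis
      proof (cases "delay i r 0 \<le> C1 r")
        case le: True
        have "delay i r t \<le> C1 r"
          by (rule upper_barrier[of "delay i r", OF der _ le t]) (auto intro: mult_nonneg_nonpos rate)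
        then show ?thesis using False le K' by (simp add: X_def)
      next
        case gt: False
        have "C1 r \<le> delay i r t"
          by (rule lower_barrier[of "delay i r", OF der _ _ t]) (use gt in \<open>auto intro: mult_nonneg_nonneg rate\<close>)
        then show ?thesis using False gt K' by (simp add: X_def)
      qed
    qed
  qed
  have X: "X \<subseteq> {-K..K}" using C by (auto simp: X_def)
  have side: "(\<forall>y\<in>X. C1 r \<le> y) \<or> (\<forall>y\<in>X. y \<le> C1 r)" if "C2 r - C1 r = 0"
    using that by (auto simp: X_def)
  obtain w w' k where w: "0 < k"
    "\<And>y. y \<in> X \<Longrightarrow> (w has_real_derivative w' y) (at y)"
    "\<And>y \<zeta>. y \<in> X \<Longrightarrow> \<bar>\<zeta>\<bar> \<le> 2 * K \<Longrightarrow>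
       k * (y - (C1 r + (C2 r - C1 r) * sigmoid (\<beta> (other i) * \<zeta>)))^2
       \<le> (w' y - \<zeta>) * (y - (C1 r + (C2 r - C1 r) * sigmoid (\<beta> (other i) * \<zeta>)))"
    by (rule route_potential_exists[of "\<beta> (other i)" "C2 r - C1 r" "2 * K" X K "C1 r"])
       (use \<beta>_pos d K X C side in auto)
  have "continuous_on X w"
    using DERIV_isCont[OF w(2)] by (simp add: continuous_at_imp_continuous_on)
  moreover have "compact X" by (simp add: X_def)
  ultimately have "compact (w ` X)" by (rule compact_continuous_image)
  then obtain m where m: "\<And>y. y \<in> X \<Longrightarrow> m \<le> w y"
    using compact_imp_bounded bounded_imp_bdd_below unfolding bdd_below_def by (metis image_eqI)
  show ?thesis
    unfolding target_def
    by (intro exI[of _ w] exI[of _ w'] exI[of _ k] exI[of _ m] conjI allI impI w(1) w(2) w(3) m in_X abs_gap_le)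
qed

lemma uniformly_continuous_solution: "uniformly_continuous_on {0..} x"
proof -
  obtain L where L: "L-lipschitz_on (cube K) (mean_field \<beta> C1 C2)"
    using mean_field_lipschitz_on_cube by blast
  have "bounded (mean_field \<beta> C1 C2 ` cube K)"
    by (intro compact_imp_bounded compact_continuous_image lipschitz_on_continuous_on[OF L] compact_cube)
  then obtain B where B: "\<And>y. y \<in> cube K \<Longrightarrow> norm (mean_field \<beta> C1 C2 y) \<le> B"
    by (auto simp: bounded_iff)
  have "B-lipschitz_on {0..} x"
  proof (rule bounded_derivative_imp_lipschitz)
    fix t :: real assume "t \<in> {0..}"
    then have t: "0 \<le> t" by simp
    show "(x has_derivative (\<lambda>h. h *\<^sub>R mean_field \<beta> C1 C2 (x t))) (at t within {0..})"
      using x t by (simp add: solution_from_def has_vector_derivative_def)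
    show "onorm (\<lambda>h. h *\<^sub>R mean_field \<beta> C1 C2 (x t)) \<le> B"
      using mult_left_mono[OF B[OF in_cube[OF t]]]
      by (intro onorm_le) (simp add: mult.commute[of B])
  next
    show "0 \<le> B" by (rule order_trans[OF norm_ge_zero B[OF in_cube[OF order_refl]]])
  qed simp
  then show ?thesis by (rule lipschitz_on_uniformly_continuous)
qed

text \<open>
  This is where the Lyapunov function \<open>V\<close> acts. Because \<open>gap i 2 = - gap i 1\<close>, the derivative of
  \<open>gap 1 1 * gap 2 1\<close> is the sum over all \<open>i\<close> and \<open>r\<close> of \<open>- gap (other i) r\<close> times the velocity of
  \<open>delay i r\<close>.
\<close>

lemma delay_tracks_target: "((\<lambda>t. delay i r t - target i r t) \<longlongrightarrow> 0) at_top"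
proof -
  obtain W W' k m where k: "\<And>i r. 0 < k i r"
    and W: "\<And>i r t. 0 \<le> t \<Longrightarrow> (W i r has_real_derivative W' i r (delay i r t)) (at (delay i r t))"
    and steep: "\<And>i r t. 0 \<le> t \<Longrightarrow> k i r * (delay i r t - target i r t)^2
              \<le> (W' i r (delay i r t) - gap (other i) r t) * (delay i r t - target i r t)"
    and m: "\<And>i r t. 0 \<le> t \<Longrightarrow> m i r \<le> W i r (delay i r t)"
    using route_potential by metis
  define V where "V t = gap 1 1 t * gap 2 1 t + (\<Sum>i\<in>UNIV. \<Sum>r\<in>UNIV. W i r (delay i r t))" for t
  define v where "v i r t = rate i r t * (target i r t - delay i r t)" for i r t
  define V' where "V' t = (\<Sum>i\<in>UNIV. \<Sum>r\<in>UNIV. (W' i r (delay i r t) - gap (other i) r t) * v i r t)" for t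
  define g where "g t = (\<Sum>i\<in>UNIV. \<Sum>r\<in>UNIV. min_rate * k i r * (delay i r t - target i r t)^2)" for t
  have V: "(V has_real_derivative V' t) (at t within {0..})" if t: "0 \<le> t" for t
  proof -
    have dW: "((\<lambda>t. W i r (delay i r t)) has_real_derivative W' i r (delay i r t) * v i r t) (at t within {0..})" for i r
      unfolding v_def by (rule DERIV_chain2[OF W[OF t] DERIV_delay[OF t]])
    have dgap: "(gap i 1 has_real_derivative v i 2 t - v i 1 t) (at t within {0..})" for i
      unfolding gap_def[abs_def] v_def other_simps by (intro derivative_intros DERIV_delay t)
    have "gap i 2 t = - gap i 1 t" for i by (simp add: gap_def)
    then show ?thesis
      unfolding V_def[abs_def] V'_def
      by (rule_tac DERIV_cong[OF DERIV_add[OF DERIV_mult[OF dgap dgap] DERIV_sum[OF DERIV_sum[OF dW]]]])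
         (simp add: sum_2 algebra_simps)
  qed
  have dec: "V' t \<le> - g t" if t: "0 \<le> t" for t
  proof -
    have "(W' i r (delay i r t) - gap (other i) r t) * v i r t
        \<le> - (min_rate * k i r * (delay i r t - target i r t)^2)" for i r
    proof -
      have "min_rate * (k i r * (delay i r t - target i r t)^2)
          \<le> rate i r t * ((W' i r (delay i r t) - gap (other i) r t) * (delay i r t - target i r t))"
      proof (rule mult_mono[OF rate_ge[OF t] steep[OF t]])
        show "0 \<le> rate i r t" using rate_ge[OF t] min_rate_pos by (rule order_trans[OF less_imp_le, rotated])
        show "0 \<le> k i r * (delay i r t - target i r t)^2" using k[of i r] by simp
      qed
      then show ?thesis by (simp add: v_def algebra_simps)
    qed
    then show ?thesis unfolding V'_def g_def sum_negf[symmetric] by (intro sum_mono) auto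
  qed
  have below: "- (2 * K * (2 * K)) + (\<Sum>i\<in>UNIV. \<Sum>r\<in>UNIV. m i r) \<le> V t" if t: "0 \<le> t" for t
  proof -
    have "\<bar>gap 1 1 t * gap 2 1 t\<bar> \<le> 2 * K * (2 * K)"
      unfolding abs_mult using abs_gap_le[OF t] K by (intro mult_mono) auto
    moreover have "(\<Sum>i\<in>UNIV. \<Sum>r\<in>UNIV. m i r) \<le> (\<Sum>i\<in>UNIV. \<Sum>r\<in>UNIV. W i r (delay i r t))"
      by (intro sum_mono m t)
    ultimately show ?thesis unfolding V_def by linarith
  qed
  have unif: "uniformly_continuous_on {0..} g"
  proof -
    define G where "G y = (\<Sum>i\<in>UNIV. \<Sum>r\<in>UNIV. min_rate * k i r * (y $ i $ r - cost \<beta> C1 C2 i r (y $ other i))^2)" for y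
    have "continuous_on (cube K) G"
      unfolding G_def cost_eq by (intro continuous_intros)
    then have "uniformly_continuous_on (cube K) G"
      by (rule compact_uniformly_continuous[OF _ compact_cube])
    moreover have "x ` {0..} \<subseteq> cube K" using in_cube by auto
    ultimately have "uniformly_continuous_on (x ` {0..}) G"
      unfolding uniformly_continuous_on_def by (meson subsetD)
    then have "uniformly_continuous_on {0..} (\<lambda>t. G (x t))"
      by (rule uniformly_continuous_on_compose[OF uniformly_continuous_solution])
    then show ?thesis by (simp add: G_def g_def[abs_def] target_eq_cost delay_def)
  qed
  have summand: "min_rate * k i r * (delay i r t - target i r t)^2 \<le> g t" for i r t
  proof -
    have nonneg: "0 \<le> min_rate * k i r * (delay i r t - target i r t)^2" for i r
      using min_rate_pos k[of i r] by simp
    have "min_rate * k i r * (delay i r t - target i r t)^2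
        \<le> (\<Sum>r\<in>UNIV. min_rate * k i r * (delay i r t - target i r t)^2)"
      by (rule member_le_sum) (auto intro: nonneg)
    also have "\<dots> \<le> g t"
      unfolding g_def by (rule member_le_sum) (auto intro: nonneg sum_nonneg)
    finally show ?thesis .
  qed
  have g_nonneg: "0 \<le> g t" for t
    unfolding g_def using min_rate_pos k by (intro sum_nonneg mult_nonneg_nonneg) (auto intro: less_imp_le)
  have "(g \<longlongrightarrow> 0) at_top"
    by (rule dissipation_tendsto_0[OF V dec g_nonneg below unif])
  then show ?thesis
    by (rule tendsto_0_if_square_dominated[of _ _ "min_rate * k i r"]) (use summand min_rate_pos k in auto)
qed

lemma continuous_on_gap: "continuous_on {0..} (gap i r)"
proof -
  have "continuous_on {0..} (delay i r)" for i r
    using DERIV_continuous_on[OF DERIV_delay] by auto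
  then show ?thesis unfolding gap_def[abs_def] by (intro continuous_intros)
qed

text \<open>
  Since the logistic function satisfies \<open>\<sigma> (- u) = 1 - \<sigma> u\<close>, the difference of the two travel times of
  player \<open>i\<close> is a single logistic function of the gap of the opponent. Its offset and amplitude are
  the same for both players.
\<close>

lemma gap_tracks_response:
  assumes j: "j = other i"
  shows "((\<lambda>t. gap i 2 t - (C1 1 - C2 2 + (C2 1 - C1 1 + (C2 2 - C1 2)) * sigmoid (- \<beta> j * gap j 2 t))) \<longlongrightarrow> 0) at_top"
proof -
  have "((\<lambda>t. (delay i 1 t - target i 1 t) - (delay i 2 t - target i 2 t)) \<longlongrightarrow> 0 - 0) at_top"
    by (intro tendsto_diff delay_tracks_target)
  moreover have "(delay i 1 t - target i 1 t) - (delay i 2 t - target i 2 t)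
      = gap i 2 t - (C1 1 - C2 2 + (C2 1 - C1 1 + (C2 2 - C1 2)) * sigmoid (- \<beta> j * gap j 2 t))" for t
  proof -
    have "gap j 1 t = - gap j 2 t" by (simp add: gap_def)
    then have "target i 1 t = C1 1 + (C2 1 - C1 1) * sigmoid (- \<beta> j * gap j 2 t)"
      by (simp add: target_def j[symmetric])
    moreover have "target i 2 t = C1 2 + (C2 2 - C1 2) * (1 - sigmoid (- \<beta> j * gap j 2 t))"
      by (simp add: target_def j[symmetric] sigmoid_minus)
    ultimately show ?thesis by (simp add: gap_def[of i] algebra_simps)
  qed
  ultimately show ?thesis by simp
qed

text \<open>
  Replacing the gap of the opponent by its own asymptotic value turns the two relations of
  \<open>gap_tracks_response\<close> into a fixed point equation for one gap. The replacement costs an error that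
  vanishes because the response is Lipschitz.
\<close>

lemma gap_converges: "\<exists>l. (gap i 2 \<longlongrightarrow> l) at_top"
proof -
  define j where "j = other i"
  have i: "i = other j" using exhaust_2[of i] by (auto simp: j_def)
  define c where "c = C1 1 - C2 2"
  define d where "d = C2 1 - C1 1 + (C2 2 - C1 2)"
  have d: "0 \<le> d" using C_le[of 1] C_le[of 2] by (simp add: d_def)
  define h where "h k z = c + d * sigmoid (- \<beta> k * z)" for k z
  have ij: "((\<lambda>t. gap i 2 t - h j (gap j 2 t)) \<longlongrightarrow> 0) at_top"
    unfolding h_def c_def d_def by (rule gap_tracks_response) (simp add: j_def)
  have ji: "((\<lambda>t. gap j 2 t - h i (gap i 2 t)) \<longlongrightarrow> 0) at_top"
    unfolding h_def c_def d_def by (rule gap_tracks_response) (simp add: i)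
  have h_lip: "\<bar>h j u - h j v\<bar> \<le> d * \<beta> j * \<bar>u - v\<bar>" for u v
  proof -
    have "\<bar>sigmoid (- \<beta> j * u) - sigmoid (- \<beta> j * v)\<bar> \<le> \<bar>- \<beta> j * u - - \<beta> j * v\<bar>"
      using lipschitz_onD[OF lipschitz_on_sigmoid[of UNIV], of "- \<beta> j * u" "- \<beta> j * v"]
      unfolding dist_real_def by simp
    also have "\<dots> = \<bar>- \<beta> j * (u - v)\<bar>" by (simp add: algebra_simps)
    also have "\<dots> = \<beta> j * \<bar>u - v\<bar>" using \<beta>_pos[of j] by (simp add: abs_mult)
    finally have "d * \<bar>sigmoid (- \<beta> j * u) - sigmoid (- \<beta> j * v)\<bar> \<le> d * (\<beta> j * \<bar>u - v\<bar>)"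
      using d by (rule mult_left_mono)
    moreover have "h j u - h j v = d * (sigmoid (- \<beta> j * u) - sigmoid (- \<beta> j * v))"
      by (simp add: h_def algebra_simps)
    ultimately show ?thesis using d by (simp add: abs_mult)
  qed
  have "((\<lambda>t. h j (gap j 2 t) - h j (h i (gap i 2 t))) \<longlongrightarrow> 0) at_top"
  proof (rule tendsto_0_le[OF ji, of _ "d * \<beta> j"])
    show "\<forall>\<^sub>F t in at_top. norm (h j (gap j 2 t) - h j (h i (gap i 2 t)))
        \<le> norm (gap j 2 t - h i (gap i 2 t)) * (d * \<beta> j)"
      using h_lip by (intro always_eventually allI) (simp only: real_norm_def mult.commute[of _ "d * \<beta> j"])
  qed
  from tendsto_add[OF ij this]
  have asym: "((\<lambda>t. gap i 2 t - h j (h i (gap i 2 t))) \<longlongrightarrow> 0) at_top" by simp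
  show ?thesis
  proof (rule asymptotic_fixed_point_converges[OF continuous_on_gap abs_gap_le asym])
    show "\<exists>z\<in>{a<..<b}. h j (h i z) \<noteq> z" if "a < b" for a b
      unfolding h_def by (rule response_fixed_points_isolated[OF \<beta>_pos \<beta>_pos d that])
  qed auto
qed

lemma solution_converges: "\<exists>e. rest_point \<beta> C1 C2 e \<and> (x \<longlongrightarrow> e) at_top"
proof -
  obtain l where l: "\<And>i. (gap i 2 \<longlongrightarrow> l i) at_top" using gap_converges by metis
  have "\<exists>l. (gap i r \<longlongrightarrow> l) at_top" for i r
  proof -
    have "gap i 1 t = - gap i 2 t" for t by (simp add: gap_def)
    then have "gap i 1 = (\<lambda>t. - gap i 2 t)" by auto
    then have "(gap i 1 \<longlongrightarrow> - l i) at_top" using tendsto_minus[OF l] by simp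
    then show ?thesis using l[of i] exhaust_2[of r] by auto
  qed
  then obtain u where u: "\<And>i r. (gap i r \<longlongrightarrow> u i r) at_top" by metis
  define e :: state where
    "e = (\<chi> i r. C1 r + (C2 r - C1 r) * sigmoid (\<beta> (other i) * u (other i) r))"
  have sigmoid_tendsto: "((\<lambda>t. sigmoid (f t)) \<longlongrightarrow> sigmoid a) F" if "(f \<longlongrightarrow> a) F" for f :: "real \<Rightarrow> real" and a F
    using DERIV_isCont[OF DERIV_sigmoid] that by (rule isCont_tendsto_compose)
  have target: "(target i r \<longlongrightarrow> e $ i $ r) at_top" for i r
    unfolding target_def[abs_def] e_def by (simp, intro tendsto_intros sigmoid_tendsto u)
  have delay: "(delay i r \<longlongrightarrow> e $ i $ r) at_top" for i r
    using tendsto_add[OF delay_tracks_target[of i r] target[of i r]] by simp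
  then have lim: "(x \<longlongrightarrow> e) at_top"
    unfolding delay_def[abs_def] by (intro vec_tendstoI)
  have u_eq: "u i r = e $ i $ other r - e $ i $ r" for i r
  proof (rule tendsto_unique[OF _ u])
    show "(gap i r \<longlongrightarrow> e $ i $ other r - e $ i $ r) at_top"
      unfolding gap_def[abs_def] by (intro tendsto_diff delay)
  qed simp
  have "rest_point \<beta> C1 C2 e"
    unfolding rest_point_def cost_eq u_eq[symmetric] by (simp add: e_def)
  with lim show ?thesis by blast
qed

end

lemma flow_converges: "\<exists>e. rest_point \<beta> C1 C2 e \<and> ((\<lambda>t. flow \<beta> C1 C2 t x0) \<longlongrightarrow> e) at_top"
proof -
  obtain x K where x: "solution_from \<beta> C1 C2 x0 x" and K: "cost_bound \<le> K" "0 < K"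
    and cube: "\<And>t. 0 \<le> t \<Longrightarrow> x t \<in> cube K" and flow: "\<And>t. 0 \<le> t \<Longrightarrow> flow \<beta> C1 C2 t x0 = x t"
    by (rule flow_is_bounded_solution[of x0]) (rule that)
  obtain e where e: "rest_point \<beta> C1 C2 e" "(x \<longlongrightarrow> e) at_top"
    using solution_converges[OF x K cube] by blast
  have "\<forall>\<^sub>F t in at_top. x t = flow \<beta> C1 C2 t x0"
    using eventually_ge_at_top[of 0] by eventually_elim (simp add: flow)
  then have "((\<lambda>t. flow \<beta> C1 C2 t x0) \<longlongrightarrow> e) at_top"
    using e(2) by (rule Lim_transform_eventually[rotated])
  with e(1) show ?thesis by blast
qed

end

theorem theorem3:
  fixes \<beta> :: "player \<Rightarrow> real" and C1 C2 :: "route \<Rightarrow> real"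
  assumes "\<And>i. \<beta> i > 0"
    and "\<And>r. C1 r \<le> C2 r"
  shows "(AE x0 in lebesgue. \<exists>e. rest_point \<beta> C1 C2 e \<and>
            ((\<lambda>t. flow \<beta> C1 C2 t x0) \<longlongrightarrow> e) at_top) \<and>
         closure (\<Union>e\<in>{e. rest_point \<beta> C1 C2 e}. basin \<beta> C1 C2 e) = UNIV"
proof -
  interpret traffic_game \<beta> C1 C2
    using assms by unfold_locales
  have "(\<Union>e\<in>{e. rest_point \<beta> C1 C2 e}. basin \<beta> C1 C2 e) = UNIV"
    using flow_converges by (auto simp: basin_def)
  then show ?thesis using flow_converges by simp
qed

end
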